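(* Let $p,q$ be positive integers and consider a $p:q$ homogeneous weight system $$\frac{dx}{dt}=-py^{2p-1}+\sum_{kp+jq>(2p-1)q}a_{kj}x^ky^j,\qquad \frac{dy}{dt}=qx^{2q-1}+\sum_{kp+jq>(2q-1)p}b_{kj}x^ky^j,$$ with return map expansion $\tilde r(2\pi,h)=\sum_{k\ge1}\nu_k(2\pi)h^k$ (defined in the context). If $p+q$ is an even number, then the first subscript $k>1$ with $\nu_k(2\pi)\neq0$ (if there is one) is an odd number.
   Context: The right-hand sides of the system are real power series in $x,y$ with nonzero radius of convergence. Put $\mathcal X_m(x,y)=\sum_{kp+jq=m}a_{kj}x^ky^j$ and $\mathcal Y_m(x,y)=\sum_{kp+jq=m}b_{kj}x^ky^j$ for the higher-order terms, with the leading terms $\mathcal X_{2pq-q}=-py^{2p-1}$, $\mathcal Y_{2pq-p}=qx^{2q-1}$. The substitution $x=r^p\cos\theta$, $y=r^q\sin\theta$ transforms the system into $$\frac{dr}{d\theta}=r\,\frac{\sum_{k\ge0}R_k(\theta)r^k}{\sum_{k\ge0}Q_k(\theta)r^k},$$ where $R_k(\theta)=\cos\theta\,\mathcal X_{2pq-q+k}(\cos\theta,\sin\theta)+\sin\theta\,\mathcal Y_{2pq-p+k}(\cos\theta,\sin\theta)$ and $Q_k(\theta)=-q\sin\theta\,\mathcal X_{2pq-q+k}(\cos\theta,\sin\theta)+p\cos\theta\,\mathcal Y_{2pq-p+k}(\cos\theta,\sin\theta)$; in particular $Q_0(\theta)=pq(\cos^{2q}\theta+\sin^{2p}\theta)>0$.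 This equation is considered for small $r$ of either sign. For sufficiently small real $h$ (of either sign) let $\tilde r(\theta,h)=\sum_{k\ge1}\nu_k(\theta)h^k$ be its solution with $\tilde r(0,h)=h$; it is a power series in $h$ with nonzero radius of convergence for $|\theta|<4\pi$, with $\nu_1(0)=1$, $\nu_k(0)=0$ for $k\ge2$, and $\nu_1(\theta)=(\cos^{2q}\theta+\sin^{2p}\theta)^{-1/(2pq)}$. *)

theory Defs
  imports "HOL-Analysis.Analysis"
begin

text \<open>
  The planar system
    x' = - p y^(2p-1) + (sum over k p + j q > (2p-1) q of a k j * x^k * y^j),
    y' =   q x^(2q-1) + (sum over k p + j q > (2q-1) p of b k j * x^k * y^j)
  is represented by the weights p, q and the coefficient families a, b. Values of a, b outside the
  index sets of the two sums are irrelevant: no definition below looks at them.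
\<close>

definition higher_indices :: "nat \<Rightarrow> nat \<Rightarrow> nat \<Rightarrow> (nat \<times> nat) set" where
  "higher_indices p q m = {(k, j). k * p + j * q > m}"

text \<open>
  Absolute convergence of the double series at one point (\<rho>, \<rho>) with \<rho> > 0, i.e. on a
  neighbourhood of the origin (unconditional and absolute summability coincide for reals).
\<close>

definition pos_radius :: "(nat \<times> nat) set \<Rightarrow> (nat \<Rightarrow> nat \<Rightarrow> real) \<Rightarrow> bool" where
  "pos_radius I c \<longleftrightarrow> (\<exists>\<rho>>0. (\<lambda>(k, j). c k j * \<rho> ^ k * \<rho> ^ j) summable_on I)"

definition weight_system ::
    "nat \<Rightarrow> nat \<Rightarrow> (nat \<Rightarrow> nat \<Rightarrow> real) \<Rightarrow> (nat \<Rightarrow> nat \<Rightarrow> real) \<Rightarrow> bool" where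
  "weight_system p q a b \<longleftrightarrow> p > 0 \<and> q > 0 \<and>
     pos_radius (higher_indices p q ((2 * p - 1) * q)) a \<and>
     pos_radius (higher_indices p q ((2 * q - 1) * p)) b"

text \<open>For positive weights the sum below is finite.\<close>

definition weighted_part ::
    "nat \<Rightarrow> nat \<Rightarrow> (nat \<Rightarrow> nat \<Rightarrow> real) \<Rightarrow> nat \<Rightarrow> real \<Rightarrow> real \<Rightarrow> real" where
  "weighted_part p q c m x y = (\<Sum>(k, j) | k * p + j * q = m. c k j * x ^ k * y ^ j)"

text \<open>Only weights m at least that of the leading term are ever used.\<close>

definition x_part ::
    "nat \<Rightarrow> nat \<Rightarrow> (nat \<Rightarrow> nat \<Rightarrow> real) \<Rightarrow> nat \<Rightarrow> real \<Rightarrow> real \<Rightarrow> real" where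
  "x_part p q a m x y =
     (if m = 2 * p * q - q then - real p * y ^ (2 * p - 1) else weighted_part p q a m x y)"

definition y_part ::
    "nat \<Rightarrow> nat \<Rightarrow> (nat \<Rightarrow> nat \<Rightarrow> real) \<Rightarrow> nat \<Rightarrow> real \<Rightarrow> real \<Rightarrow> real" where
  "y_part p q b m x y =
     (if m = 2 * p * q - p then real q * x ^ (2 * q - 1) else weighted_part p q b m x y)"

text \<open>
  The substitution x = r^p cos \<theta>, y = r^q sin \<theta> turns the system into
  dr/d\<theta> = r * (sum of R k \<theta> * r^k) / (sum of Q k \<theta> * r^k) with the following R and Q.
\<close>

definition R_coeff ::
    "nat \<Rightarrow> nat \<Rightarrow> (nat \<Rightarrow> nat \<Rightarrow> real) \<Rightarrow> (nat \<Rightarrow> nat \<Rightarrow> real) \<Rightarrow> nat \<Rightarrow> real \<Rightarrow> real" where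
  "R_coeff p q a b k \<theta> =
     cos \<theta> * x_part p q a (2 * p * q - q + k) (cos \<theta>) (sin \<theta>) +
     sin \<theta> * y_part p q b (2 * p * q - p + k) (cos \<theta>) (sin \<theta>)"

definition Q_coeff ::
    "nat \<Rightarrow> nat \<Rightarrow> (nat \<Rightarrow> nat \<Rightarrow> real) \<Rightarrow> (nat \<Rightarrow> nat \<Rightarrow> real) \<Rightarrow> nat \<Rightarrow> real \<Rightarrow> real" where
  "Q_coeff p q a b k \<theta> =
     - real q * sin \<theta> * x_part p q a (2 * p * q - q + k) (cos \<theta>) (sin \<theta>) +
     real p * cos \<theta> * y_part p q b (2 * p * q - p + k) (cos \<theta>) (sin \<theta>)"

lemma Q_coeff_0:
  assumes "p > 0" "q > 0"
  shows "Q_coeff p q a b 0 \<theta> = real p * real q * (cos \<theta> ^ (2 * q) + sin \<theta> ^ (2 * p))"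
proof -
  have "sin \<theta> ^ (2 * p) = sin \<theta> * sin \<theta> ^ (2 * p - 1)"
    and "cos \<theta> ^ (2 * q) = cos \<theta> * cos \<theta> ^ (2 * q - 1)"
    using assms by (simp_all flip: power_Suc)
  then show ?thesis
    by (simp add: Q_coeff_def x_part_def y_part_def algebra_simps)
qed

text \<open>
  Summability and the nonvanishing denominator are part of being a solution, because the infinite
  sums and the quotient are total functions with arbitrary values otherwise. Both hold
  automatically as long as the solution stays small.
\<close>

definition polar_solution ::
    "nat \<Rightarrow> nat \<Rightarrow> (nat \<Rightarrow> nat \<Rightarrow> real) \<Rightarrow> (nat \<Rightarrow> nat \<Rightarrow> real) \<Rightarrow> real \<Rightarrow> (real \<Rightarrow> real) \<Rightarrow> bool" where
  "polar_solution p q a b h r \<longleftrightarrow> r 0 = h \<and>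
     (\<forall>\<theta>. \<bar>\<theta>\<bar> < 4 * pi \<longrightarrow>
        summable (\<lambda>k. R_coeff p q a b k \<theta> * r \<theta> ^ k) \<and>
        summable (\<lambda>k. Q_coeff p q a b k \<theta> * r \<theta> ^ k) \<and>
        (\<Sum>k. Q_coeff p q a b k \<theta> * r \<theta> ^ k) \<noteq> 0 \<and>
        (r has_real_derivative
           r \<theta> * ((\<Sum>k. R_coeff p q a b k \<theta> * r \<theta> ^ k) / (\<Sum>k. Q_coeff p q a b k \<theta> * r \<theta> ^ k)))
          (at \<theta>))"

text \<open>
  The radius of convergence of the expansion in h may depend on \<theta>; a uniform one is not required.
  The value \<nu> 0 \<theta> plays no role.
\<close>

definition solution_expansion ::
    "nat \<Rightarrow> nat \<Rightarrow> (nat \<Rightarrow> nat \<Rightarrow> real) \<Rightarrow> (nat \<Rightarrow> nat \<Rightarrow> real) \<Rightarrow>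
     (real \<Rightarrow> real \<Rightarrow> real) \<Rightarrow> (nat \<Rightarrow> real \<Rightarrow> real) \<Rightarrow> bool" where
  "solution_expansion p q a b r \<nu> \<longleftrightarrow>
     (\<exists>\<delta>>0. \<forall>h. \<bar>h\<bar> < \<delta> \<longrightarrow> polar_solution p q a b h (\<lambda>\<theta>. r \<theta> h)) \<and>
     (\<forall>\<theta>. \<bar>\<theta>\<bar> < 4 * pi \<longrightarrow>
        (\<exists>\<epsilon>>0. \<forall>h. \<bar>h\<bar> < \<epsilon> \<longrightarrow> (\<lambda>k. \<nu> (Suc k) \<theta> * h ^ Suc k) sums r \<theta> h))"

end

theory Submission
  imports Defs
begin

text \<open>
  For even p and q the polar equation is invariant under r \<mapsto> -r, so the return map is odd and all its
  even coefficients vanish. For odd p and q it is invariant under (r, \<theta>) \<mapsto> (-r, \<theta> + \<pi>), so the return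
  map is P = S o S with S h = - r(\<pi>, h) and S'(0) = -1; an order-reversing S cannot commute with a map
  for which P h - h has a fixed strict sign around 0, and P h - h would have one if its order were even.
  Both arguments use uniqueness of small solutions, obtained from a Lipschitz bound that is
  uniform in \<theta>.
\<close>

text \<open>The hypotheses supply \<open>r\<close> and \<open>\<nu>\<close>, but neither a bound on
  \<open>r\<close> along the way nor the value of \<open>\<nu> 1\<close>. The Lipschitz bound rests
  on two facts uniform in \<open>\<theta>\<close>: geometric bounds for \<open>R_coeff\<close> and
  \<open>Q_coeff\<close>, inherited from absolute convergence of the double series, and a positive
  lower bound for \<open>Q_coeff\<close> at index 0. It holds only for small \<open>r\<close>, so
  uniqueness also requires a continuation argument that keeps solutions in that range. The value
  S'(0) = -1 enters twice: its sign makes S reverse the order near 0, and its square makes the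
  linear coefficient of P equal to 1, so that P h - h starts with the first nonzero coefficient
  beyond the linear one.\<close>

section \<open>Power series with geometrically bounded coefficients, and their quotients\<close>

lemma power_series_summable_bound:
  fixes c :: "nat \<Rightarrow> real"
  assumes c: "\<And>k. \<bar>c k\<bar> \<le> C * K ^ k" and K: "K > 0" and x: "\<bar>x\<bar> \<le> 1 / (4 * K)"
  shows "summable (\<lambda>k. c k * x ^ k)"
proof (rule summable_comparison_test')
  show "summable (\<lambda>k. C * (1/4) ^ k :: real)"
    by (intro summable_mult summable_geometric) simp
  show "norm (c k * x ^ k) \<le> C * (1/4) ^ k" if "k \<ge> 0" for k
  proof -
    have "\<bar>x\<bar> ^ k \<le> (1 / (4 * K)) ^ k" using x by (intro power_mono) auto
    then have "\<bar>c k\<bar> * \<bar>x\<bar> ^ k \<le> (C * K ^ k) * (1 / (4 * K)) ^ k"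
      using c[of k] by (intro mult_mono) auto
    also have "\<dots> = C * (1/4) ^ k"
      using K by (simp add: power_divide power_mult_distrib)
    finally show ?thesis by (simp add: abs_mult power_abs)
  qed
qed

lemma abs_power_diff_le:
  fixes x y t :: real
  assumes "\<bar>x\<bar> \<le> t" "\<bar>y\<bar> \<le> t"
  shows "\<bar>x ^ Suc k - y ^ Suc k\<bar> \<le> real (Suc k) * t ^ k * \<bar>x - y\<bar>"
proof -
  have "\<bar>\<Sum>i<Suc k. x ^ i * y ^ (k - i)\<bar> \<le> (\<Sum>i<Suc k. \<bar>x ^ i * y ^ (k - i)\<bar>)"
    by (rule sum_abs)
  also have "\<dots> \<le> (\<Sum>i<Suc k. t ^ k)"
  proof (rule sum_mono)
    fix i assume i: "i \<in> {..<Suc k}"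
    have "\<bar>x\<bar> ^ i * \<bar>y\<bar> ^ (k - i) \<le> t ^ i * t ^ (k - i)"
      using assms by (intro mult_mono power_mono) auto
    then show "\<bar>x ^ i * y ^ (k - i)\<bar> \<le> t ^ k"
      using i by (simp add: abs_mult power_abs flip: power_add)
  qed
  finally have *: "\<bar>\<Sum>i<Suc k. x ^ i * y ^ (k - i)\<bar> \<le> real (Suc k) * t ^ k" by simp
  have "x ^ Suc k - y ^ Suc k = (x - y) * (\<Sum>i<Suc k. x ^ i * y ^ (k - i))"
    by (rule diff_power_eq_sum)
  then show ?thesis
    using mult_left_mono[OF *, of "\<bar>x - y\<bar>"] by (simp add: abs_mult mult.commute)
qed

text \<open>With t = 1/(4K) the k-th difference is at most C K^k * k t^(k-1) |x - y| = 4CK |x - y| *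
  k / 4^k for k > 0, and k < 2^k turns this into a geometric series of ratio 1/2. The radius 1/(4K),
  rather than 1/K, pays for the factor k.\<close>

lemma power_series_lipschitz:
  fixes c :: "nat \<Rightarrow> real"
  assumes c: "\<And>k. \<bar>c k\<bar> \<le> C * K ^ k" and K: "K > 0"
    and x: "\<bar>x\<bar> \<le> 1 / (4 * K)" and y: "\<bar>y\<bar> \<le> 1 / (4 * K)"
  shows "\<bar>(\<Sum>k. c k * x ^ k) - (\<Sum>k. c k * y ^ k)\<bar> \<le> 8 * C * K * \<bar>x - y\<bar>"
proof -
  have C: "C \<ge> 0" using c[of 0] by simp
  have sx: "summable (\<lambda>k. c k * x ^ k)" and sy: "summable (\<lambda>k. c k * y ^ k)"
    using power_series_summable_bound[of c C K] assms by auto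
  define g where "g k = (4 * C * K * \<bar>x - y\<bar>) * (1/2) ^ k" for k :: nat
  have sg: "summable g" unfolding g_def by (intro summable_mult summable_geometric) simp
  have le: "norm (c k * x ^ k - c k * y ^ k) \<le> g k" for k
  proof (cases k)
    case 0
    then show ?thesis using C K by (simp add: g_def)
  next
    case (Suc n)
    have "\<bar>c k\<bar> * \<bar>x ^ k - y ^ k\<bar> \<le> (C * K ^ k) * (real k * (1 / (4 * K)) ^ n * \<bar>x - y\<bar>)"
      using c[of k] abs_power_diff_le[OF x y, of n] C K Suc by (intro mult_mono) auto
    also have "\<dots> = 4 * C * K * \<bar>x - y\<bar> * (real k * (1/4) ^ k)"
      using K Suc by (simp add: power_divide power_mult_distrib)
    also have "\<dots> \<le> 4 * C * K * \<bar>x - y\<bar> * (2 ^ k * (1/4) ^ k)"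
      using C K of_nat_less_two_power[of k, where 'a = real]
      by (intro mult_left_mono mult_right_mono) auto
    also have "\<dots> = g k" by (simp add: g_def flip: power_mult_distrib)
    finally show ?thesis by (simp add: abs_mult flip: right_diff_distrib)
  qed
  have "(\<Sum>k. c k * x ^ k) - (\<Sum>k. c k * y ^ k) = (\<Sum>k. c k * x ^ k - c k * y ^ k)"
    using sx sy by (rule suminf_diff)
  also have "norm \<dots> \<le> suminf g"
    using le sg by (rule norm_suminf_le)
  also have "suminf g = (4 * C * K * \<bar>x - y\<bar>) * 2"
    unfolding g_def by (subst suminf_mult) (auto simp: suminf_geometric intro: summable_geometric)
  finally show ?thesis by simp
qed

text \<open>\<open>C\<close>, \<open>K\<close> and \<open>c\<close> do not depend on
  \<open>t\<close>, hence neither do \<open>\<rho>\<close> and \<open>L\<close>. The first estimate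
  feeds the Gronwall arguments; the second, which compares \<open>H t x\<close> with
  \<open>H t 0\<close>, controls the deviation from the linearised equation.\<close>

lemma quotient_lipschitz:
  fixes R Q :: "nat \<Rightarrow> 'a \<Rightarrow> real"
  assumes R: "\<And>k t. \<bar>R k t\<bar> \<le> C * K ^ k" and Q: "\<And>k t. \<bar>Q k t\<bar> \<le> C * K ^ k"
    and Q0: "\<And>t. Q 0 t \<ge> c" and C: "C > 0" and K: "K > 0" and c: "c > 0"
  defines "H \<equiv> \<lambda>t x. (\<Sum>k. R k t * x ^ k) / (\<Sum>k. Q k t * x ^ k)"
  obtains \<rho> L where "\<rho> > 0" "L > 0"
    "\<And>t x y. \<bar>x\<bar> \<le> \<rho> \<Longrightarrow> \<bar>y\<bar> \<le> \<rho> \<Longrightarrow> \<bar>x * H t x - y * H t y\<bar> \<le> L * \<bar>x - y\<bar>"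
    "\<And>t x. \<bar>x\<bar> \<le> \<rho> \<Longrightarrow> \<bar>x * H t x - x * (R 0 t / Q 0 t)\<bar> \<le> L * x\<^sup>2"
proof -
  \<comment> \<open>The first bound keeps both series in the range of their Lipschitz estimate. The
    second gives 8CK|x| <= c/2, so the denominator, at least \<open>c\<close> at 0, stays at least
    c/2.\<close>
  define \<rho> where "\<rho> = min (1 / (4 * K)) (c / (16 * C * K))"
  define A where "A t x = (\<Sum>k. R k t * x ^ k)" for t x
  define D where "D t x = (\<Sum>k. Q k t * x ^ k)" for t x
  have \<rho>: "\<rho> > 0" using C K c by (simp add: \<rho>_def)
  have \<rho>K: "\<bar>x\<bar> \<le> 1 / (4 * K)" if "\<bar>x\<bar> \<le> \<rho>" for x using that by (simp add: \<rho>_def)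
  have A0: "A t 0 = R 0 t" and D0: "D t 0 = Q 0 t" for t
    by (simp_all add: A_def D_def powser_zero)
  have Al: "\<bar>A t x - A t y\<bar> \<le> 8 * C * K * \<bar>x - y\<bar>"
    and Dl: "\<bar>D t x - D t y\<bar> \<le> 8 * C * K * \<bar>x - y\<bar>" if "\<bar>x\<bar> \<le> \<rho>" "\<bar>y\<bar> \<le> \<rho>" for t x y
    unfolding A_def D_def
    using power_series_lipschitz[of "\<lambda>k. R k t" C K x y] power_series_lipschitz[of "\<lambda>k. Q k t" C K x y]
      R Q K \<rho>K that by auto
  have small: "8 * C * K * \<bar>x\<bar> \<le> 2 * C" "8 * C * K * \<bar>x\<bar> \<le> c / 2" if "\<bar>x\<bar> \<le> \<rho>" for x
  proof -
    have "8 * C * K * \<bar>x\<bar> \<le> 8 * C * K * (1 / (4 * K))"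
      using \<rho>K[OF that] C K by (intro mult_left_mono) auto
    then show "8 * C * K * \<bar>x\<bar> \<le> 2 * C" using K by simp
    have "8 * C * K * \<bar>x\<bar> \<le> 8 * C * K * (c / (16 * C * K))"
      using that C K by (intro mult_left_mono) (auto simp: \<rho>_def)
    then show "8 * C * K * \<bar>x\<bar> \<le> c / 2" using C K by simp
  qed
  \<comment> \<open>3C is the bound C on the constant coefficient plus a variation of at most
    2C.\<close>
  have Ab: "\<bar>A t x\<bar> \<le> 3 * C" and Db: "\<bar>D t x\<bar> \<le> 3 * C" and Dc: "D t x \<ge> c / 2"
    if "\<bar>x\<bar> \<le> \<rho>" for t x
    using Al[of x 0 t] Dl[of x 0 t] that \<rho> small[OF that] R[of 0 t] Q[of 0 t] Q0[of t] A0[of t] D0[of t]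
    by (auto simp: abs_le_iff)
  define L0 where "L0 = 2 * (3 * C * (8 * C * K)) / (c / 2)\<^sup>2"
  have L0: "L0 > 0" using C K c by (simp add: L0_def)
  have H: "H t x = A t x / D t x" for t x by (simp add: H_def A_def D_def)
  have Hl: "\<bar>H t x - H t y\<bar> \<le> L0 * \<bar>x - y\<bar>" if "\<bar>x\<bar> \<le> \<rho>" "\<bar>y\<bar> \<le> \<rho>" for t x y
  proof -
    have D: "D t x \<ge> c / 2" "D t y \<ge> c / 2" using Dc that by auto
    have D': "D t x > 0" "D t y > 0" using D c by linarith+
    have "H t x - H t y = ((A t x - A t y) * D t y - A t y * (D t x - D t y)) / (D t x * D t y)"
      using D' by (simp add: H field_simps)
    then have "\<bar>H t x - H t y\<bar> =
        \<bar>(A t x - A t y) * D t y - A t y * (D t x - D t y)\<bar> / (D t x * D t y)"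
      using D' by (simp add: abs_mult)
    also have "\<dots> \<le> (2 * (3 * C * (8 * C * K * \<bar>x - y\<bar>))) / ((c / 2) * (c / 2))"
    proof (rule frac_le)
      have "\<bar>(A t x - A t y) * D t y\<bar> \<le> (8 * C * K * \<bar>x - y\<bar>) * (3 * C)"
        using Al[OF that, of t] Db[OF that(2), of t] unfolding abs_mult by (intro mult_mono) auto
      moreover have "\<bar>A t y * (D t x - D t y)\<bar> \<le> (3 * C) * (8 * C * K * \<bar>x - y\<bar>)"
        using Dl[OF that, of t] Ab[OF that(2), of t] unfolding abs_mult by (intro mult_mono) auto
      ultimately show "\<bar>(A t x - A t y) * D t y - A t y * (D t x - D t y)\<bar>
          \<le> 2 * (3 * C * (8 * C * K * \<bar>x - y\<bar>))"
        using abs_triangle_ineq4[of "(A t x - A t y) * D t y" "A t y * (D t x - D t y)"]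
        by (simp add: mult.commute)
      show "c / 2 * (c / 2) \<le> D t x * D t y" using D c by (intro mult_mono) auto
    qed (use c C K in auto)
    finally show ?thesis by (simp add: L0_def power2_eq_square)
  qed
  have Hb: "\<bar>H t x\<bar> \<le> 6 * C / c" if "\<bar>x\<bar> \<le> \<rho>" for t x
  proof -
    have "\<bar>H t x\<bar> = \<bar>A t x\<bar> / D t x" using Dc[OF that, of t] c by (simp add: H)
    also have "\<dots> \<le> 3 * C / (c / 2)"
      using Ab[OF that, of t] Dc[OF that, of t] c C by (intro frac_le) auto
    finally show ?thesis by simp
  qed
  define L where "L = 6 * C / c + \<rho> * L0 + L0"
  have L: "L > 0" using L0 \<rho> C c by (simp add: L_def add_pos_pos)
  show ?thesis
  proof (rule that[OF \<rho> L])
    fix t x y assume xy: "\<bar>x\<bar> \<le> \<rho>" "\<bar>y\<bar> \<le> \<rho>"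
    have "x * H t x - y * H t y = (x - y) * H t x + y * (H t x - H t y)" by (simp add: algebra_simps)
    also have "\<bar>\<dots>\<bar> \<le> \<bar>x - y\<bar> * \<bar>H t x\<bar> + \<bar>y\<bar> * \<bar>H t x - H t y\<bar>"
      by (simp add: abs_triangle_ineq flip: abs_mult)
    also have "\<dots> \<le> \<bar>x - y\<bar> * (6 * C / c) + \<rho> * (L0 * \<bar>x - y\<bar>)"
      using Hb[OF xy(1)] Hl[OF xy] xy \<rho> by (intro add_mono mult_mono) auto
    also have "\<dots> \<le> L * \<bar>x - y\<bar>" using L0 by (simp add: L_def algebra_simps)
    finally show "\<bar>x * H t x - y * H t y\<bar> \<le> L * \<bar>x - y\<bar>" .
  next
    fix t x assume x: "\<bar>x\<bar> \<le> \<rho>"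
    have "\<bar>x * H t x - x * (R 0 t / Q 0 t)\<bar> = \<bar>x\<bar> * \<bar>H t x - H t 0\<bar>"
      by (simp only: H A0 D0 abs_mult flip: right_diff_distrib)
    also have "\<dots> \<le> \<bar>x\<bar> * (L0 * \<bar>x\<bar>)" using Hl[OF x, of 0 t] \<rho> by (intro mult_left_mono) auto
    also have "\<dots> \<le> L * x\<^sup>2"
      using \<rho> C c L0 by (auto simp: L_def power2_eq_square algebra_simps)
    finally show "\<bar>x * H t x - x * (R 0 t / Q 0 t)\<bar> \<le> L * x\<^sup>2" .
  qed
qed

section \<open>Gronwall estimates and uniqueness of small solutions\<close>

text \<open>The function w^2 exp(-2Lt) has nonpositive derivative. Squaring avoids the points where
  |w| is not differentiable, and the sign of a derivative suffices, so \<open>w'\<close> is never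
  integrated.\<close>

lemma gronwall_abs:
  fixes w w' :: "real \<Rightarrow> real"
  assumes T: "0 \<le> T"
    and w: "\<And>t. 0 \<le> t \<Longrightarrow> t \<le> T \<Longrightarrow> (w has_real_derivative w' t) (at t)"
    and le: "\<And>t. 0 \<le> t \<Longrightarrow> t \<le> T \<Longrightarrow> \<bar>w' t\<bar> \<le> L * \<bar>w t\<bar>"
  shows "\<bar>w T\<bar> \<le> \<bar>w 0\<bar> * exp (L * T)"
proof -
  have "(w T)\<^sup>2 * exp (- 2 * L * T) \<le> (w 0)\<^sup>2 * exp (- 2 * L * 0)"
  proof (rule DERIV_nonpos_imp_nonincreasing[OF T])
    fix t assume t: "0 \<le> t" "t \<le> T"
    have "((\<lambda>t. (w t)\<^sup>2 * exp (- 2 * L * t)) has_real_derivative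
        2 * (w t * w' t - L * (w t)\<^sup>2) * exp (- 2 * L * t)) (at t)"
      using w[OF t] by (auto intro!: derivative_eq_intros simp: algebra_simps power2_eq_square)
    moreover have "w t * w' t \<le> L * (w t)\<^sup>2"
    proof -
      have "w t * w' t \<le> \<bar>w t\<bar> * \<bar>w' t\<bar>" by (metis abs_ge_self abs_mult)
      also have "\<dots> \<le> \<bar>w t\<bar> * (L * \<bar>w t\<bar>)" using le[OF t] by (intro mult_left_mono) auto
      finally show ?thesis by (simp add: power2_eq_square algebra_simps)
    qed
    ultimately show "\<exists>y. ((\<lambda>t. (w t)\<^sup>2 * exp (- 2 * L * t)) has_real_derivative y) (at t) \<and> y \<le> 0"
      by (intro exI[of _ "2 * (w t * w' t - L * (w t)\<^sup>2) * exp (- 2 * L * t)"] conjI)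
         (simp_all add: mult_nonpos_nonneg)
  qed
  then have "(w T)\<^sup>2 \<le> (\<bar>w 0\<bar> * exp (L * T))\<^sup>2"
    by (simp add: power_mult_distrib exp_minus field_simps flip: exp_double)
  then show ?thesis by (simp add: abs_le_square_iff[symmetric])
qed

text \<open>The growth bound on \<open>F\<close> is available only for |x| <= \<open>\<rho>\<close>,
  and nothing says in advance that \<open>u\<close> remains there. At a first time \<open>s1\<close>
  with |u| >= \<open>\<rho>\<close>, Gronwall on [0, s1] would still give a value below
  \<open>\<rho>\<close>.\<close>

lemma solution_stays_small:
  fixes u :: "real \<Rightarrow> real"
  assumes lip: "\<And>t x. \<bar>x\<bar> \<le> \<rho> \<Longrightarrow> \<bar>F t x\<bar> \<le> L * \<bar>x\<bar>" and L: "L > 0"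
    and u: "\<And>t. 0 \<le> t \<Longrightarrow> t \<le> T \<Longrightarrow> (u has_real_derivative F t (u t)) (at t)"
    and small: "\<bar>u 0\<bar> * exp (L * T) < \<rho>" and t: "0 \<le> t" "t \<le> T"
  shows "\<bar>u t\<bar> < \<rho>" and "\<bar>u t\<bar> \<le> \<bar>u 0\<bar> * exp (L * T)"
proof -
  have mono: "\<bar>u 0\<bar> * exp (L * s) \<le> \<bar>u 0\<bar> * exp (L * T)" if "s \<le> T" for s
    using that L by (intro mult_left_mono) auto
  have cont: "continuous_on {0..T} (\<lambda>t. \<bar>u t\<bar>)"
    by (intro continuous_intros DERIV_continuous_on[of _ u "\<lambda>t. F t (u t)"])
       (auto intro: has_field_derivative_at_within u)
  have grow: "\<bar>u s\<bar> \<le> \<bar>u 0\<bar> * exp (L * s)"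
    if "0 \<le> s" "s \<le> T" "\<And>v. 0 \<le> v \<Longrightarrow> v \<le> s \<Longrightarrow> \<bar>u v\<bar> \<le> \<rho>" for s
    using gronwall_abs[of s u "\<lambda>t. F t (u t)" L] that u lip by auto
  have *: "\<bar>u s\<bar> < \<rho>" if s: "0 \<le> s" "s \<le> T" for s
  proof (rule ccontr)
    assume "\<not> \<bar>u s\<bar> < \<rho>"
    define E where "E = {0..T} \<inter> (\<lambda>t. \<bar>u t\<bar>) -` {\<rho>..}"
    have "closed E"
      unfolding E_def by (rule continuous_closed_preimage[OF cont]) auto
    then have "compact E"
      using bounded_subset[OF bounded_closed_interval, of E 0 T]
      unfolding compact_eq_bounded_closed E_def by blast
    moreover have "E \<noteq> {}" using s \<open>\<not> \<bar>u s\<bar> < \<rho>\<close> by (auto simp: E_def)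
    ultimately obtain s1 where s1: "s1 \<in> E" and least: "\<And>v. v \<in> E \<Longrightarrow> s1 \<le> v"
      by (rule compact_attains_inf[THEN bexE]) auto
    have s1T: "0 \<le> s1" "s1 \<le> T" "\<bar>u s1\<bar> \<ge> \<rho>" using s1 by (auto simp: E_def)
    have below: "\<bar>u v\<bar> \<le> \<rho>" if "0 \<le> v" "v < s1" for v
      using least[of v] that s1T by (cases "\<rho> \<le> \<bar>u v\<bar>") (auto simp: E_def)
    have "0 < s1"
    proof (rule ccontr)
      assume "\<not> 0 < s1"
      then have "s1 = 0" using s1T by simp
      then show False using s1T small mono[of 0] by simp
    qed
    \<comment> \<open>Minimality of \<open>s1\<close> controls only earlier times; the bound at
      \<open>s1\<close> itself, which Gronwall on the closed interval requires, is a limit from the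
      left.\<close>
    have "\<bar>u s1\<bar> \<le> \<rho>"
    proof (rule tendsto_upperbound)
      have "isCont u s1" using u s1T DERIV_isCont by blast
      then show "((\<lambda>t. \<bar>u t\<bar>) \<longlongrightarrow> \<bar>u s1\<bar>) (at_left s1)"
        by (intro tendsto_rabs) (auto simp: isCont_def filterlim_at_split)
      show "\<forall>\<^sub>F v in at_left s1. \<bar>u v\<bar> \<le> \<rho>"
        using below \<open>0 < s1\<close> by (auto simp: eventually_at_left_field intro!: exI[of _ 0])
    qed simp
    then have "\<bar>u s1\<bar> \<le> \<bar>u 0\<bar> * exp (L * s1)"
      using grow[of s1] s1T below by (metis order_le_less)
    then show False using mono[of s1] small s1T by linarith
  qed
  show "\<bar>u t\<bar> < \<rho>" using * t by blast
  have "\<bar>u t\<bar> \<le> \<bar>u 0\<bar> * exp (L * t)" using grow[OF t] * t by (meson less_imp_le order_trans)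
  then show "\<bar>u t\<bar> \<le> \<bar>u 0\<bar> * exp (L * T)" using mono[OF t(2)] by linarith
qed

text \<open>Smallness is demanded of the common initial value alone: it confines both solutions to
  the region where \<open>F\<close> is Lipschitz, and Gronwall then applies to their difference,
  which starts at 0.\<close>

lemma small_solutions_unique:
  fixes u v :: "real \<Rightarrow> real"
  assumes lip: "\<And>t x y. \<bar>x\<bar> \<le> \<rho> \<Longrightarrow> \<bar>y\<bar> \<le> \<rho> \<Longrightarrow> \<bar>F t x - F t y\<bar> \<le> L * \<bar>x - y\<bar>"
    and F0: "\<And>t. F t 0 = 0" and L: "L > 0"
    and u: "\<And>t. 0 \<le> t \<Longrightarrow> t \<le> T \<Longrightarrow> (u has_real_derivative F t (u t)) (at t)"
    and v: "\<And>t. 0 \<le> t \<Longrightarrow> t \<le> T \<Longrightarrow> (v has_real_derivative F t (v t)) (at t)"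
    and eq: "u 0 = v 0" and small: "\<bar>u 0\<bar> * exp (L * T) < \<rho>" and T: "0 \<le> T"
  shows "u T = v T"
proof -
  have "\<rho> > 0" using small by (smt (verit) exp_gt_zero mult_nonneg_nonneg)
  then have lip0: "\<bar>F t x\<bar> \<le> L * \<bar>x\<bar>" if "\<bar>x\<bar> \<le> \<rho>" for t x
    using lip[of x 0 t] that F0 by simp
  have ub: "\<bar>u t\<bar> < \<rho>" if "0 \<le> t" "t \<le> T" for t
    using solution_stays_small(1)[OF lip0 L u small that] by blast
  have vb: "\<bar>v t\<bar> < \<rho>" if "0 \<le> t" "t \<le> T" for t
    using solution_stays_small(1)[OF lip0 L v small[unfolded eq] that] by blast
  have "\<bar>u T - v T\<bar> \<le> \<bar>u 0 - v 0\<bar> * exp (L * T)"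
  proof (rule gronwall_abs[OF T, where w' = "\<lambda>t. F t (u t) - F t (v t)"])
    fix t assume t: "0 \<le> t" "t \<le> T"
    show "((\<lambda>t. u t - v t) has_real_derivative F t (u t) - F t (v t)) (at t)"
      using u[OF t] v[OF t] by (rule DERIV_diff)
    show "\<bar>F t (u t) - F t (v t)\<bar> \<le> L * \<bar>u t - v t\<bar>"
      using lip ub[OF t] vb[OF t] by (simp add: less_imp_le)
  qed
  then show ?thesis using eq by simp
qed


section \<open>The polar field: uniform bounds and linearisation\<close>

text \<open>For large \<open>x\<close> the sums and the quotient may take default values. The
  estimates are therefore restricted to small \<open>x\<close>, whereas the symmetries below act
  term by term and hold for every \<open>x\<close>.\<close>

definition polar_field ::
    "nat \<Rightarrow> nat \<Rightarrow> (nat \<Rightarrow> nat \<Rightarrow> real) \<Rightarrow> (nat \<Rightarrow> nat \<Rightarrow> real) \<Rightarrow> real \<Rightarrow> real \<Rightarrow> real" where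
  "polar_field p q a b \<theta> x =
     x * ((\<Sum>k. R_coeff p q a b k \<theta> * x ^ k) / (\<Sum>k. Q_coeff p q a b k \<theta> * x ^ k))"

text \<open>A monomial of weight m has degree k + j <= m because both weights are at least 1. Hence
  sigma^m <= rho^k rho^j for sigma = min rho 1, and the part of weight m, multiplied by sigma^m, is
  dominated by the absolutely convergent double series. Only \<open>k > 0\<close> is covered, since
  the weight \<open>n\<close> itself lies outside \<open>higher_indices p q n\<close>.\<close>

lemma weighted_part_geometric_bound:
  assumes c: "pos_radius (higher_indices p q n) c" and pq: "p > 0" "q > 0"
  obtains C K where "C > 0" "K \<ge> 1"
    "\<And>k x y. k > 0 \<Longrightarrow> \<bar>x\<bar> \<le> 1 \<Longrightarrow> \<bar>y\<bar> \<le> 1 \<Longrightarrow> \<bar>weighted_part p q c (n + k) x y\<bar> \<le> C * K ^ k"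
proof -
  obtain \<rho> where \<rho>: "\<rho> > 0"
    and sm: "(\<lambda>(k, j). c k j * \<rho> ^ k * \<rho> ^ j) summable_on higher_indices p q n"
    using c by (auto simp: pos_radius_def)
  define f where "f = (\<lambda>(k, j). \<bar>c k j * \<rho> ^ k * \<rho> ^ j\<bar>)"
  have "f = (\<lambda>z. norm ((\<lambda>(k, j). c k j * \<rho> ^ k * \<rho> ^ j) z))"
    by (auto simp: f_def fun_eq_iff)
  then have fs: "f summable_on higher_indices p q n"
    using sm[THEN summable_on_iff_abs_summable_on_real[THEN iffD1]] by (simp only:)
  have f0: "f z \<ge> 0" for z by (auto simp: f_def split: prod.splits)
  define B where "B = infsum f (higher_indices p q n)"
  define \<sigma> where "\<sigma> = min \<rho> 1"
  have B: "B \<ge> 0" unfolding B_def by (rule infsum_nonneg) (rule f0)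
  have \<sigma>: "0 < \<sigma>" "\<sigma> \<le> 1" "\<sigma> \<le> \<rho>" using \<rho> by (auto simp: \<sigma>_def)
  have bound: "\<bar>weighted_part p q c m x y\<bar> * \<sigma> ^ m \<le> B"
    if m: "m > n" and xy: "\<bar>x\<bar> \<le> 1" "\<bar>y\<bar> \<le> 1" for m x y
  proof -
    define S where "S = {(k, j). k * p + j * q = m}"
    have le: "k + j \<le> m" if "(k, j) \<in> S" for k j
    proof -
      have "k * 1 + j * 1 \<le> k * p + j * q" using pq by (intro add_mono mult_le_mono2) auto
      then show ?thesis using that by (simp add: S_def)
    qed
    have "z \<in> {..m} \<times> {..m}" if "z \<in> S" for z
      using that le[of "fst z" "snd z"] by (cases z) simp
    then have "S \<subseteq> {..m} \<times> {..m}" by blast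
    then have fin: "finite S" by (rule finite_subset) auto
    have "\<bar>weighted_part p q c m x y\<bar> \<le> (\<Sum>z\<in>S. \<bar>(\<lambda>(k, j). c k j * x ^ k * y ^ j) z\<bar>)"
      unfolding weighted_part_def S_def by (rule sum_abs)
    then have "\<bar>weighted_part p q c m x y\<bar> * \<sigma> ^ m
        \<le> (\<Sum>z\<in>S. \<bar>(\<lambda>(k, j). c k j * x ^ k * y ^ j) z\<bar>) * \<sigma> ^ m"
      using \<sigma> by (intro mult_right_mono) auto
    also have "\<dots> = (\<Sum>z\<in>S. \<bar>(\<lambda>(k, j). c k j * x ^ k * y ^ j) z\<bar> * \<sigma> ^ m)"
      by (rule sum_distrib_right)
    also have "\<dots> \<le> (\<Sum>z\<in>S. f z)"
    proof (rule sum_mono)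
      fix z assume z: "z \<in> S"
      obtain k j where kj: "z = (k, j)" by (cases z)
      have "\<bar>x\<bar> ^ k * \<bar>y\<bar> ^ j * \<sigma> ^ m \<le> 1 * 1 * \<sigma> ^ (k + j)"
        using xy \<sigma> le z kj by (intro mult_mono power_le_one power_decreasing) auto
      also have "\<dots> \<le> \<rho> ^ k * \<rho> ^ j"
        unfolding power_add using \<sigma> by (auto intro!: mult_mono power_mono)
      finally have "\<bar>c k j\<bar> * (\<bar>x\<bar> ^ k * \<bar>y\<bar> ^ j * \<sigma> ^ m) \<le> \<bar>c k j\<bar> * (\<rho> ^ k * \<rho> ^ j)"
        by (intro mult_left_mono) auto
      then show "\<bar>(\<lambda>(k, j). c k j * x ^ k * y ^ j) z\<bar> * \<sigma> ^ m \<le> f z"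
        using \<rho> by (simp add: kj f_def abs_mult power_abs mult.assoc)
    qed
    also have "\<dots> \<le> B"
      unfolding B_def using fs fin m f0
      by (intro finite_sum_le_infsum) (auto simp: S_def higher_indices_def)
    finally show ?thesis .
  qed
  \<comment> \<open>The power of sigma belonging to the offset \<open>n\<close> is absorbed into the
    constant; adding 1 keeps \<open>C\<close> positive when all coefficients vanish.\<close>
  define C where "C = B / \<sigma> ^ n + 1"
  show ?thesis
  proof (rule that)
    show "C > 0" using B \<sigma> by (simp add: C_def add_nonneg_pos)
    show "1 / \<sigma> \<ge> 1" using \<sigma> by simp
    fix k :: nat and x y :: real assume "k > 0" "\<bar>x\<bar> \<le> 1" "\<bar>y\<bar> \<le> 1"
    then have "\<bar>weighted_part p q c (n + k) x y\<bar> \<le> B / \<sigma> ^ (n + k)"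
      using bound[of "n + k" x y] \<sigma> by (simp add: pos_le_divide_eq)
    also have "\<dots> = B / \<sigma> ^ n * (1 / \<sigma>) ^ k" by (simp add: power_add power_divide)
    also have "\<dots> \<le> C * (1 / \<sigma>) ^ k" using \<sigma> by (intro mult_right_mono) (auto simp: C_def)
    finally show "\<bar>weighted_part p q c (n + k) x y\<bar> \<le> C * (1 / \<sigma>) ^ k" .
  qed
qed

lemma coeff_geometric_bound:
  assumes "weight_system p q a b"
  obtains C K where "C > 0" "K > 0"
    "\<And>k \<theta>. \<bar>R_coeff p q a b k \<theta>\<bar> \<le> C * K ^ k" "\<And>k \<theta>. \<bar>Q_coeff p q a b k \<theta>\<bar> \<le> C * K ^ k"
proof -
  have pq: "p > 0" "q > 0" using assms by (auto simp: weight_system_def)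
  have n: "(2 * p - 1) * q = 2 * p * q - q" "(2 * q - 1) * p = 2 * p * q - p"
    unfolding diff_mult_distrib by (simp_all add: ac_simps)
  have rad: "pos_radius (higher_indices p q (2 * p * q - q)) a"
      "pos_radius (higher_indices p q (2 * p * q - p)) b"
    using assms by (simp_all add: weight_system_def flip: n)
  obtain Ca Ka where Ca: "Ca > 0" "Ka \<ge> 1"
    "\<And>k x y. k > 0 \<Longrightarrow> \<bar>x\<bar> \<le> 1 \<Longrightarrow> \<bar>y\<bar> \<le> 1 \<Longrightarrow>
       \<bar>weighted_part p q a (2 * p * q - q + k) x y\<bar> \<le> Ca * Ka ^ k"
    using weighted_part_geometric_bound[OF rad(1) pq] by blast
  obtain Cb Kb where Cb: "Cb > 0" "Kb \<ge> 1"
    "\<And>k x y. k > 0 \<Longrightarrow> \<bar>x\<bar> \<le> 1 \<Longrightarrow> \<bar>y\<bar> \<le> 1 \<Longrightarrow>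
       \<bar>weighted_part p q b (2 * p * q - p + k) x y\<bar> \<le> Cb * Kb ^ k"
    using weighted_part_geometric_bound[OF rad(2) pq] by blast
  define K where "K = max Ka Kb"
  \<comment> \<open>\<open>Ca\<close> and \<open>Cb\<close> serve the higher parts. The summands
    \<open>p\<close> and \<open>q\<close> serve k = 0, where \<open>x_part\<close> and
    \<open>y_part\<close> use the prescribed leading terms instead of a weighted part.\<close>
  define D where "D = real p + real q + Ca + Cb"
  have K: "K \<ge> 1" using Ca by (simp add: K_def)
  have D: "D > 0" using Ca Cb by (simp add: D_def add_nonneg_pos)
  have X: "\<bar>x_part p q a (2 * p * q - q + k) x y\<bar> \<le> D * K ^ k"
    and Y: "\<bar>y_part p q b (2 * p * q - p + k) x y\<bar> \<le> D * K ^ k"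
    if xy: "\<bar>x\<bar> \<le> 1" "\<bar>y\<bar> \<le> 1" for k x y
  proof -
    have "real p * \<bar>y\<bar> ^ (2 * p - 1) \<le> real p * 1" "real q * \<bar>x\<bar> ^ (2 * q - 1) \<le> real q * 1"
      using xy by (intro mult_left_mono power_le_one; simp)+
    moreover have "Ca * Ka ^ k \<le> D * K ^ k" "Cb * Kb ^ k \<le> D * K ^ k"
      using Ca Cb by (intro mult_mono power_mono; simp add: D_def K_def)+
    moreover have "real p \<le> D" "real q \<le> D" using Ca Cb by (simp_all add: D_def)
    ultimately show "\<bar>x_part p q a (2 * p * q - q + k) x y\<bar> \<le> D * K ^ k"
        "\<bar>y_part p q b (2 * p * q - p + k) x y\<bar> \<le> D * K ^ k"
      using Ca(3)[of k x y] Cb(3)[of k x y] xy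
      by (cases "k = 0"; simp add: x_part_def y_part_def abs_mult power_abs)+
  qed
  define C where "C = (2 + real p + real q) * D"
  show ?thesis
  proof (rule that)
    show "C > 0" using D by (simp add: C_def add_pos_nonneg)
    show "K > 0" using K by simp
    fix k \<theta>
    let ?X = "x_part p q a (2 * p * q - q + k) (cos \<theta>) (sin \<theta>)"
    let ?Y = "y_part p q b (2 * p * q - p + k) (cos \<theta>) (sin \<theta>)"
    have XY: "\<bar>?X\<bar> \<le> D * K ^ k" "\<bar>?Y\<bar> \<le> D * K ^ k" using X Y by auto
    have DK: "D * K ^ k \<ge> 0" using D K by simp
    have t: "\<bar>cos \<theta> * z\<bar> \<le> D * K ^ k" "\<bar>sin \<theta> * z\<bar> \<le> D * K ^ k" if "\<bar>z\<bar> \<le> D * K ^ k" for z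
      using mult_mono[of "\<bar>cos \<theta>\<bar>" 1 "\<bar>z\<bar>" "D * K ^ k"] mult_mono[of "\<bar>sin \<theta>\<bar>" 1 "\<bar>z\<bar>" "D * K ^ k"] that
      by (simp_all add: abs_mult)
    have "\<bar>R_coeff p q a b k \<theta>\<bar> \<le> 2 * (D * K ^ k)"
      unfolding R_coeff_def using t(1)[OF XY(1)] t(2)[OF XY(2)] by linarith
    also have "\<dots> \<le> (2 + real p + real q) * (D * K ^ k)" using DK by (intro mult_right_mono) auto
    finally show "\<bar>R_coeff p q a b k \<theta>\<bar> \<le> C * K ^ k" by (simp add: C_def)
    have "\<bar>real q * (sin \<theta> * ?X)\<bar> \<le> real q * (D * K ^ k)" "\<bar>real p * (cos \<theta> * ?Y)\<bar> \<le> real p * (D * K ^ k)"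
      using mult_left_mono[OF t(2)[OF XY(1)], of "real q"] mult_left_mono[OF t(1)[OF XY(2)], of "real p"]
      by (simp_all only: abs_mult abs_of_nat of_nat_0_le_iff simp_thms)
    then have "\<bar>Q_coeff p q a b k \<theta>\<bar> \<le> real q * (D * K ^ k) + real p * (D * K ^ k)"
      unfolding Q_coeff_def by (simp only: mult_minus_left mult.assoc)
    also have "\<dots> \<le> (2 + real p + real q) * (D * K ^ k)" using DK by (simp add: algebra_simps)
    finally show "\<bar>Q_coeff p q a b k \<theta>\<bar> \<le> C * K ^ k" by (simp add: C_def)
  qed
qed

text \<open>One of cos^2 and sin^2 is at least 1/2. This bounds \<open>Q_coeff\<close> at index 0
  away from zero, explicitly and uniformly in the angle.\<close>

lemma cos_sin_powers_ge: "(1/2) ^ (p + q) \<le> cos \<theta> ^ (2 * q) + sin \<theta> ^ (2 * p :: nat)"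
  for \<theta> :: real
proof -
  have "(cos \<theta>)\<^sup>2 \<ge> 1/2 \<or> (sin \<theta>)\<^sup>2 \<ge> 1/2" using sin_cos_squared_add[of \<theta>] by linarith
  then show ?thesis
  proof
    assume "(cos \<theta>)\<^sup>2 \<ge> 1/2"
    then have "(1/2) ^ q \<le> cos \<theta> ^ (2 * q)" unfolding power_mult by (intro power_mono) auto
    moreover have "(1/2) ^ (p + q) \<le> (1/2 :: real) ^ q" by (intro power_decreasing) auto
    moreover have "sin \<theta> ^ (2 * p) \<ge> 0" by (simp add: power_mult)
    ultimately show ?thesis by linarith
  next
    assume "(sin \<theta>)\<^sup>2 \<ge> 1/2"
    then have "(1/2) ^ p \<le> sin \<theta> ^ (2 * p)" unfolding power_mult by (intro power_mono) auto
    moreover have "(1/2) ^ (p + q) \<le> (1/2 :: real) ^ p" by (intro power_decreasing) auto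
    moreover have "cos \<theta> ^ (2 * q) \<ge> 0" by (simp add: power_mult)
    ultimately show ?thesis by linarith
  qed
qed

lemma polar_field_lipschitz:
  assumes ws: "weight_system p q a b"
  obtains \<rho> L where "\<rho> > 0" "L > 0"
    "\<And>\<theta> x y. \<bar>x\<bar> \<le> \<rho> \<Longrightarrow> \<bar>y\<bar> \<le> \<rho> \<Longrightarrow>
       \<bar>polar_field p q a b \<theta> x - polar_field p q a b \<theta> y\<bar> \<le> L * \<bar>x - y\<bar>"
    "\<And>\<theta> x. \<bar>x\<bar> \<le> \<rho> \<Longrightarrow>
       \<bar>polar_field p q a b \<theta> x - x * (R_coeff p q a b 0 \<theta> / Q_coeff p q a b 0 \<theta>)\<bar> \<le> L * x\<^sup>2"
proof -
  have pq: "p > 0" "q > 0" using ws by (auto simp: weight_system_def)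
  obtain C K where CK: "C > 0" "K > 0"
    "\<And>k \<theta>. \<bar>R_coeff p q a b k \<theta>\<bar> \<le> C * K ^ k" "\<And>k \<theta>. \<bar>Q_coeff p q a b k \<theta>\<bar> \<le> C * K ^ k"
    using coeff_geometric_bound[OF ws] by blast
  have Q0: "Q_coeff p q a b 0 \<theta> \<ge> real p * real q * (1/2) ^ (p + q)" for \<theta>
    unfolding Q_coeff_0[OF pq] by (intro mult_left_mono cos_sin_powers_ge) auto
  have c: "real p * real q * (1/2) ^ (p + q) > 0" using pq by simp
  show ?thesis
    using that by (rule quotient_lipschitz[of "R_coeff p q a b" C K "Q_coeff p q a b",
      OF CK(3,4) Q0 CK(1,2) c, folded polar_field_def])
qed

lemma polar_field_zero [simp]: "polar_field p q a b \<theta> 0 = 0"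
  by (simp add: polar_field_def)

lemma polar_solution_deriv:
  assumes "polar_solution p q a b h u" "\<bar>\<theta>\<bar> < 4 * pi"
  shows "(u has_real_derivative polar_field p q a b \<theta> (u \<theta>)) (at \<theta>)"
  using assms by (simp add: polar_solution_def polar_field_def)

text \<open>One threshold \<open>\<eta>\<close>, namely the Lipschitz radius divided by the largest
  growth factor exp(2 pi L), serves all times up to 2 pi. The time is left free because the even
  case compares solutions over a full turn and the odd case over a half turn.\<close>

lemma polar_field_unique:
  assumes ws: "weight_system p q a b"
  obtains \<eta> where "\<eta> > 0"
    "\<And>u v T. 0 \<le> T \<Longrightarrow> T \<le> 2 * pi \<Longrightarrow> \<bar>u 0\<bar> < \<eta> \<Longrightarrow> u 0 = v 0 \<Longrightarrow>
      (\<And>\<theta>. 0 \<le> \<theta> \<Longrightarrow> \<theta> \<le> T \<Longrightarrow> (u has_real_derivative polar_field p q a b \<theta> (u \<theta>)) (at \<theta>)) \<Longrightarrow>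
      (\<And>\<theta>. 0 \<le> \<theta> \<Longrightarrow> \<theta> \<le> T \<Longrightarrow> (v has_real_derivative polar_field p q a b \<theta> (v \<theta>)) (at \<theta>)) \<Longrightarrow>
      u T = v T"
proof -
  obtain \<rho> L where \<rho>: "\<rho> > 0" and L: "L > 0"
    and lip: "\<And>\<theta> x y. \<bar>x\<bar> \<le> \<rho> \<Longrightarrow> \<bar>y\<bar> \<le> \<rho> \<Longrightarrow>
       \<bar>polar_field p q a b \<theta> x - polar_field p q a b \<theta> y\<bar> \<le> L * \<bar>x - y\<bar>"
    using polar_field_lipschitz[OF ws] by metis
  show ?thesis
  proof (rule that)
    show "\<rho> / exp (L * (2 * pi)) > 0" using \<rho> by simp
    fix u v :: "real \<Rightarrow> real" and T :: real
    assume T: "0 \<le> T" "T \<le> 2 * pi" and small: "\<bar>u 0\<bar> < \<rho> / exp (L * (2 * pi))" and eq: "u 0 = v 0"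
      and u: "\<And>\<theta>. 0 \<le> \<theta> \<Longrightarrow> \<theta> \<le> T \<Longrightarrow> (u has_real_derivative polar_field p q a b \<theta> (u \<theta>)) (at \<theta>)"
      and v: "\<And>\<theta>. 0 \<le> \<theta> \<Longrightarrow> \<theta> \<le> T \<Longrightarrow> (v has_real_derivative polar_field p q a b \<theta> (v \<theta>)) (at \<theta>)"
    have "\<bar>u 0\<bar> * exp (L * T) \<le> \<bar>u 0\<bar> * exp (L * (2 * pi))"
      using T L by (intro mult_left_mono) auto
    also have "\<dots> < \<rho>" using small by (simp add: pos_less_divide_eq)
    finally have "\<bar>u 0\<bar> * exp (L * T) < \<rho>" .
    then show "u T = v T"
      using small_solutions_unique[where F = "polar_field p q a b", OF lip _ L u v eq _ T(1)] by simp
  qed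
qed

text \<open>
  With N = cos^(2q) + sin^(2p) = Q 0 / (pq) one has R 0 / Q 0 = - N' / (2pqN), so the factor N powr (1 / (2pq))
  removes the linear part of the equation.
\<close>

lemma half_turn_tangent_identity:
  assumes ws: "weight_system p q a b"
  obtains \<eta> M where "\<eta> > 0"
    "\<And>u. \<bar>u 0\<bar> < \<eta> \<Longrightarrow>
      (\<And>\<theta>. 0 \<le> \<theta> \<Longrightarrow> \<theta> \<le> pi \<Longrightarrow> (u has_real_derivative polar_field p q a b \<theta> (u \<theta>)) (at \<theta>)) \<Longrightarrow>
      \<bar>u pi - u 0\<bar> \<le> M * (u 0)\<^sup>2"
proof -
  have pq: "p > 0" "q > 0" using ws by (auto simp: weight_system_def)
  obtain \<rho> L where \<rho>: "\<rho> > 0" and L: "L > 0"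
    and lip: "\<And>\<theta> x y. \<bar>x\<bar> \<le> \<rho> \<Longrightarrow> \<bar>y\<bar> \<le> \<rho> \<Longrightarrow>
       \<bar>polar_field p q a b \<theta> x - polar_field p q a b \<theta> y\<bar> \<le> L * \<bar>x - y\<bar>"
    and lin: "\<And>\<theta> x. \<bar>x\<bar> \<le> \<rho> \<Longrightarrow>
       \<bar>polar_field p q a b \<theta> x - x * (R_coeff p q a b 0 \<theta> / Q_coeff p q a b 0 \<theta>)\<bar> \<le> L * x\<^sup>2"
    using polar_field_lipschitz[OF ws] by blast
  have lip0: "\<bar>polar_field p q a b \<theta> x\<bar> \<le> L * \<bar>x\<bar>" if "\<bar>x\<bar> \<le> \<rho>" for \<theta> x
    using lip[OF that, of 0 \<theta>] \<rho> by simp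
  define N where "N \<theta> = cos \<theta> ^ (2 * q) + sin \<theta> ^ (2 * p)" for \<theta> :: real
  define \<alpha> where "\<alpha> = 1 / (2 * real p * real q)"
  have N0: "N \<theta> > 0" for \<theta>
    using cos_sin_powers_ge[of p q \<theta>] by (smt (verit) N_def zero_less_power half_gt_zero_iff)
  have "1 * 1 \<le> real p * real q" using pq by (intro mult_mono) auto
  then have \<alpha>: "0 < \<alpha>" "\<alpha> \<le> 1" using pq by (auto simp: \<alpha>_def)
  \<comment> \<open>Both summands of \<open>N\<close> are at most 1 and the exponent is at most 1;
    this is the factor 2 in the final constant.\<close>
  have N\<alpha>: "N \<theta> powr \<alpha> \<le> 2" for \<theta>
  proof -
    have "N \<theta> \<le> 1 + 1"
      unfolding N_def power_mult
      by (intro add_mono power_le_one[of "(cos \<theta>)\<^sup>2"] power_le_one[of "(sin \<theta>)\<^sup>2"])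
         (auto simp: abs_square_le_1)
    then have "N \<theta> powr \<alpha> \<le> 2 powr \<alpha>" using N0[of \<theta>] \<alpha> by (intro powr_mono2) auto
    also have "\<dots> \<le> 2 powr 1" using \<alpha> by (intro powr_mono) auto
    finally show ?thesis by simp
  qed
  have Nd: "(N has_real_derivative - 2 * R_coeff p q a b 0 \<theta>) (at \<theta>)" for \<theta>
    unfolding N_def R_coeff_def x_part_def y_part_def
    by (auto intro!: derivative_eq_intros simp: algebra_simps)
  define E where "E = exp (L * pi)"
  show ?thesis
  proof (rule that)
    show "\<rho> / E > 0" using \<rho> by (simp add: E_def)
    fix u :: "real \<Rightarrow> real"
    assume "\<bar>u 0\<bar> < \<rho> / E"
      and u: "\<And>\<theta>. 0 \<le> \<theta> \<Longrightarrow> \<theta> \<le> pi \<Longrightarrow> (u has_real_derivative polar_field p q a b \<theta> (u \<theta>)) (at \<theta>)"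
    then have small: "\<bar>u 0\<bar> * exp (L * pi) < \<rho>" by (simp add: E_def pos_less_divide_eq)
    have ub: "\<bar>u \<theta>\<bar> < \<rho>" "\<bar>u \<theta>\<bar> \<le> \<bar>u 0\<bar> * E" if "0 \<le> \<theta>" "\<theta> \<le> pi" for \<theta>
      using solution_stays_small[of \<rho> "polar_field p q a b" L pi u, OF lip0 L u small that]
      unfolding E_def by blast+
    define g' where "g' \<theta> = N \<theta> powr \<alpha> * (polar_field p q a b \<theta> (u \<theta>) -
        u \<theta> * (R_coeff p q a b 0 \<theta> / Q_coeff p q a b 0 \<theta>))" for \<theta>
    have gd: "((\<lambda>\<theta>. u \<theta> * N \<theta> powr \<alpha>) has_real_derivative g' \<theta>) (at \<theta>)"
      if \<theta>: "0 \<le> \<theta>" "\<theta> \<le> pi" for \<theta>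
    proof -
      have Q: "Q_coeff p q a b 0 \<theta> = real p * real q * N \<theta>" unfolding Q_coeff_0[OF pq] N_def ..
      have "((\<lambda>\<theta>. N \<theta> powr \<alpha>) has_real_derivative
          \<alpha> * N \<theta> powr (\<alpha> - of_nat 1) * (- 2 * R_coeff p q a b 0 \<theta>)) (at \<theta>)"
        by (rule DERIV_fun_powr[OF Nd N0])
      also have "\<alpha> * N \<theta> powr (\<alpha> - of_nat 1) * (- 2 * R_coeff p q a b 0 \<theta>) =
          - (N \<theta> powr \<alpha> * (R_coeff p q a b 0 \<theta> / Q_coeff p q a b 0 \<theta>))"
      proof -
        have "N \<theta> powr (\<alpha> - of_nat 1) = N \<theta> powr \<alpha> / N \<theta>"
          using N0[of \<theta>] by (simp add: powr_diff)
        moreover have "\<alpha> * (A / N \<theta>) * (- 2 * B) = - (A * (B / (real p * real q * N \<theta>)))" for A B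
          using N0[of \<theta>] pq by (simp add: \<alpha>_def field_simps)
        ultimately show ?thesis unfolding Q by simp
      qed
      finally have "((\<lambda>\<theta>. u \<theta> * N \<theta> powr \<alpha>) has_real_derivative
          polar_field p q a b \<theta> (u \<theta>) * N \<theta> powr \<alpha> +
          - (N \<theta> powr \<alpha> * (R_coeff p q a b 0 \<theta> / Q_coeff p q a b 0 \<theta>)) * u \<theta>) (at \<theta>)"
        by (intro DERIV_mult u \<theta>)
      then show ?thesis by (simp add: g'_def algebra_simps)
    qed
    \<comment> \<open>\<open>N\<close> equals 1 at 0 and at pi, so the increment of u N^alpha over
      the half turn is exactly \<open>u pi - u 0\<close>. Its derivative contains only the remainder
      of the field beyond the linear term, which is quadratic in \<open>u\<close> and hence in
      \<open>u 0\<close>.\<close>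
    have "\<exists>z. 0 < z \<and> z < pi \<and> u pi * N pi powr \<alpha> - u 0 * N 0 powr \<alpha> = (pi - 0) * g' z"
      by (rule MVT2) (auto intro: gd)
    then obtain z where z: "0 < z" "z < pi" "u pi * N pi powr \<alpha> - u 0 * N 0 powr \<alpha> = pi * g' z"
      by auto
    have "\<bar>g' z\<bar> \<le> 2 * (L * (\<bar>u 0\<bar> * E)\<^sup>2)"
    proof -
      have "(u z)\<^sup>2 \<le> (\<bar>u 0\<bar> * E)\<^sup>2"
        using ub(2)[of z] z by (simp add: abs_le_square_iff[symmetric] abs_mult E_def)
      then have "L * (u z)\<^sup>2 \<le> L * (\<bar>u 0\<bar> * E)\<^sup>2" using L by (intro mult_left_mono) auto
      moreover have "\<bar>polar_field p q a b z (u z) -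
          u z * (R_coeff p q a b 0 z / Q_coeff p q a b 0 z)\<bar> \<le> L * (u z)\<^sup>2"
        using lin ub(1)[of z] z by simp
      ultimately show ?thesis
        unfolding g'_def abs_mult using N\<alpha>[of z] N0[of z] by (intro mult_mono) auto
    qed
    moreover have "N pi = 1" "N 0 = 1" using pq by (simp_all add: N_def)
    ultimately have "\<bar>u pi - u 0\<bar> \<le> pi * (2 * (L * (\<bar>u 0\<bar> * E)\<^sup>2))"
      using z by (simp add: abs_mult)
    then show "\<bar>u pi - u 0\<bar> \<le> (2 * pi * L * E\<^sup>2) * (u 0)\<^sup>2"
      by (simp add: power_mult_distrib algebra_simps)
  qed
qed

section \<open>Parity symmetries of the polar field\<close>

text \<open>For odd weights, kp + jq and k + j have the same parity.\<close>

lemma weighted_part_uminus: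
  assumes "odd p" "odd q"
  shows "weighted_part p q c m (- x) (- y) = (- 1) ^ m * weighted_part p q c m x y"
proof -
  have "c k j * (- x) ^ k * (- y) ^ j = (- 1) ^ m * (c k j * x ^ k * y ^ j)"
    if "k * p + j * q = m" for k j
  proof -
    have "even (k + j) \<longleftrightarrow> even m" using that assms by auto
    then have "(- 1 :: real) ^ (k + j) = (- 1) ^ m" by (simp add: minus_one_power_iff)
    then show ?thesis by (simp add: power_minus[of x] power_minus[of y] power_add flip: mult.assoc)
  qed
  then show ?thesis
    unfolding weighted_part_def sum_distrib_left by (intro sum.cong) auto
qed

text \<open>Both leading weights are odd, so a half turn multiplies the parts with index
  \<open>k\<close> by -(-1)^k. The sign change of the accompanying cosine or sine leaves (-1)^k,
  which cancels against (-x)^k in numerator and denominator; only the factor \<open>x\<close> in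
  front changes sign.\<close>

lemma polar_field_antipodal:
  assumes odd: "odd p" "odd q" and pq: "p > 0" "q > 0"
  shows "polar_field p q a b (\<theta> + pi) (- x) = - polar_field p q a b \<theta> x"
proof -
  have odd_diff: "odd (2 * p * q - j)" if "odd j" "j \<le> 2 * p * q" for j
  proof -
    have "even (2 * p * q - j + j)" unfolding le_add_diff_inverse2[OF that(2)] by simp
    then show ?thesis using that(1) unfolding even_add by blast
  qed
  \<comment> \<open>These inequalities rule out truncation in the natural number subtractions, on
    which the parity argument depends.\<close>
  have "1 * q \<le> (2 * p) * q" "1 * p \<le> (2 * q) * p" using pq by (intro mult_le_mono1; simp)+
  then have "q \<le> 2 * p * q" "p \<le> 2 * p * q" by (simp_all add: ac_simps)
  then have lead_odd: "odd (2 * p * q - q)" "odd (2 * p * q - p)" using odd odd_diff by blast+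
  have sign: "(- 1 :: real) ^ (2 * p * q - q + k) = - ((- 1) ^ k)"
      "(- 1 :: real) ^ (2 * p * q - p + k) = - ((- 1) ^ k)" for k
    by (simp_all only: power_add neg_one_odd_power[OF lead_odd(1)] neg_one_odd_power[OF lead_odd(2)] mult_minus1)
  have odds: "odd (2 * p - 1)" "odd (2 * q - 1)" using pq by simp_all
  have lead: "(- z) ^ (2 * p - 1) = - (z ^ (2 * p - 1))" "(- z) ^ (2 * q - 1) = - (z ^ (2 * q - 1))"
    for z :: real
    by (simp_all only: power_minus_odd[OF odds(1)] power_minus_odd[OF odds(2)])
  have X: "x_part p q a (2 * p * q - q + k) (- x) (- y) = - ((- 1) ^ k * x_part p q a (2 * p * q - q + k) x y)"
    for k x y
  proof (cases "k = 0")
    case True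
    then show ?thesis by (simp only: x_part_def lead) simp
  next
    case False
    then have ne: "2 * p * q - q + k \<noteq> 2 * p * q - q" by simp
    show ?thesis
      by (simp only: x_part_def ne if_False weighted_part_uminus[OF odd] sign mult_minus_left)
  qed
  have Y: "y_part p q b (2 * p * q - p + k) (- x) (- y) = - ((- 1) ^ k * y_part p q b (2 * p * q - p + k) x y)"
    for k x y
  proof (cases "k = 0")
    case True
    then show ?thesis by (simp only: y_part_def lead) simp
  next
    case False
    then have ne: "2 * p * q - p + k \<noteq> 2 * p * q - p" by simp
    show ?thesis
      by (simp only: y_part_def ne if_False weighted_part_uminus[OF odd] sign mult_minus_left)
  qed
  have RQ: "R_coeff p q a b k (\<theta> + pi) = (- 1) ^ k * R_coeff p q a b k \<theta>"
      "Q_coeff p q a b k (\<theta> + pi) = (- 1) ^ k * Q_coeff p q a b k \<theta>" for k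
    unfolding R_coeff_def Q_coeff_def cos_periodic_pi sin_periodic_pi X Y
    by (simp_all only: distrib_left mult_minus_left mult_minus_right minus_minus mult.left_commute)
  have cancel: "(- 1) ^ k * z * (- x) ^ k = z * x ^ k" for k z
    by (simp add: power_minus[of x] flip: power_add mult_2)
  show ?thesis unfolding polar_field_def RQ cancel by simp
qed

lemma weighted_part_eq_0:
  assumes "even p" "even q" "odd m"
  shows "weighted_part p q c m x y = 0"
  unfolding weighted_part_def using assms by (intro sum.neutral) auto

text \<open>All weights kp + jq and both leading weights are even, so the coefficients with odd
  index vanish and both series are even in \<open>x\<close>.\<close>

lemma polar_field_uminus:
  assumes even: "even p" "even q"
  shows "polar_field p q a b \<theta> (- x) = - polar_field p q a b \<theta> x"
proof -
  have "R_coeff p q a b k \<theta> = 0 \<and> Q_coeff p q a b k \<theta> = 0" if "odd k" for k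
    using that even by (cases "k = 0")
      (auto simp: R_coeff_def Q_coeff_def x_part_def y_part_def weighted_part_eq_0[OF even])
  then have RQ: "R_coeff p q a b k \<theta> * (- x) ^ k = R_coeff p q a b k \<theta> * x ^ k"
      "Q_coeff p q a b k \<theta> * (- x) ^ k = Q_coeff p q a b k \<theta> * x ^ k" for k
    by (cases "even k"; simp)+
  show ?thesis unfolding polar_field_def RQ by simp
qed

section \<open>Deviation of a power series from its linear part\<close>

text \<open>Continuity of the derivative at 0 is what later turns S'(0) = -1 into strict
  monotonicity on a whole interval.\<close>

lemma powser_derivative_near_0:
  fixes c :: "nat \<Rightarrow> real"
  assumes \<epsilon>: "\<epsilon> > 0" and f: "\<And>h. \<bar>h\<bar> < \<epsilon> \<Longrightarrow> (\<lambda>k. c k * h ^ k) sums f h"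
  obtains f' where "\<And>h. \<bar>h\<bar> < \<epsilon> \<Longrightarrow> (f has_real_derivative f' h) (at h)" "isCont f' 0" "f' 0 = c 1"
proof -
  have sm: "summable (\<lambda>k. c k * h ^ k)" if "norm h < \<epsilon>" for h
    using f that by (auto simp: sums_iff)
  have smd: "summable (\<lambda>k. diffs c k * h ^ k)" if "norm h < \<epsilon>" for h
    using that by (rule termdiff_converges) (rule sm)
  show ?thesis
  proof (rule that)
    fix h assume h: "\<bar>h\<bar> < \<epsilon>"
    have "((\<lambda>h. \<Sum>k. c k * h ^ k) has_real_derivative (\<Sum>k. diffs c k * h ^ k)) (at h)"
      using termdiffs_strong'[OF sm] h by simp
    then show "(f has_real_derivative (\<Sum>k. diffs c k * h ^ k)) (at h)"
    proof (rule has_field_derivative_transform_within_open[where S = "{-\<epsilon><..<\<epsilon>}"])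
      show "(\<Sum>k. c k * x ^ k) = f x" if "x \<in> {-\<epsilon><..<\<epsilon>}" for x
        using f[of x] that by (auto simp: sums_iff)
    qed (use h in auto)
  next
    show "isCont (\<lambda>h. \<Sum>k. diffs c k * h ^ k) 0"
      by (rule DERIV_isCont, rule termdiffs_strong'[OF smd]) (use \<epsilon> in auto)
    show "(\<Sum>k. diffs c k * 0 ^ k) = c 1" unfolding powser_zero by (simp add: diffs_def)
  qed
qed

text \<open>Dividing the tail from exponent \<open>n\<close> on by h^n leaves a power series that
  converges on the same interval, hence is continuous at 0.\<close>

lemma powser_leading_deviation:
  fixes c :: "nat \<Rightarrow> real"
  assumes \<epsilon>: "\<epsilon> > 0" and f: "\<And>h. \<bar>h\<bar> < \<epsilon> \<Longrightarrow> (\<lambda>k. c k * h ^ k) sums f h"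
    and c: "c 0 = 0" "\<And>k. 1 < k \<Longrightarrow> k < n \<Longrightarrow> c k = 0" and n: "n > 1"
  obtains g where "\<And>h. \<bar>h\<bar> < \<epsilon> \<Longrightarrow> f h = c 1 * h + h ^ n * g h" "isCont g 0" "g 0 = c n"
proof -
  have sm: "summable (\<lambda>k. c k * h ^ k)" if "norm h < \<epsilon>" for h
    using f that by (auto simp: sums_iff)
  have smn: "summable (\<lambda>k. c (k + n) * h ^ k)" if "norm h < \<epsilon>" for h
    using sm[OF that] by (simp add: summable_powser_ignore_initial_segment)
  show ?thesis
  proof (rule that)
    fix h assume h: "\<bar>h\<bar> < \<epsilon>"
    have "f h = (\<Sum>k. c k * h ^ k)" using f[OF h] by (simp add: sums_iff)
    also have "\<dots> = (\<Sum>k. c (k + n) * h ^ (k + n)) + (\<Sum>k<n. c k * h ^ k)"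
      using h by (intro suminf_split_initial_segment sm) auto
    also have "(\<Sum>k<n. c k * h ^ k) = (\<Sum>k\<in>{1}. c k * h ^ k)"
    proof (rule sum.mono_neutral_right)
      show "\<forall>i\<in>{..<n} - {1}. c i * h ^ i = 0"
      proof
        fix i assume "i \<in> {..<n} - {1}"
        then have "i = 0 \<or> 1 < i \<and> i < n" by auto
        then show "c i * h ^ i = 0" using c by auto
      qed
    qed (use n in auto)
    also have "(\<Sum>k. c (k + n) * h ^ (k + n)) = (\<Sum>k. h ^ n * (c (k + n) * h ^ k))"
      by (simp add: power_add algebra_simps)
    also have "\<dots> = h ^ n * (\<Sum>k. c (k + n) * h ^ k)"
      using h by (intro suminf_mult smn) auto
    finally show "f h = c 1 * h + h ^ n * (\<Sum>k. c (k + n) * h ^ k)" by simp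
  next
    show "isCont (\<lambda>h. \<Sum>k. c (k + n) * h ^ k) 0"
      by (rule DERIV_isCont, rule termdiffs_strong'[OF smn]) (use \<epsilon> in auto)
    show "(\<Sum>k. c (k + n) * 0 ^ k) = c n" unfolding powser_zero by simp
  qed
qed

text \<open>
  P commutes with S. If n were even, then P h - h would have the same sign at h and at S h,
  whereas the decreasing map S turns P h > h into P (S h) = S (P h) < S h.
\<close>

lemma reversing_square_deviation_odd:
  fixes s c :: "nat \<Rightarrow> real"
  assumes \<epsilon>: "\<epsilon> > 0"
    and S: "\<And>h. \<bar>h\<bar> < \<epsilon> \<Longrightarrow> (\<lambda>k. s k * h ^ k) sums S h" and s: "s 0 = 0" "s 1 = - 1"
    and P: "\<And>h. \<bar>h\<bar> < \<epsilon> \<Longrightarrow> (\<lambda>k. c k * h ^ k) sums P h" and c0: "c 0 = 0"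
    and PS: "\<forall>\<^sub>F h in nhds 0. P h = S (S h)"
    and n: "n > 1" and cn: "c n \<noteq> 0" and least: "\<And>k. 1 < k \<Longrightarrow> k < n \<Longrightarrow> c k = 0"
  shows "odd n"
proof
  assume even: "even n"
  obtain S' where S': "\<And>h. \<bar>h\<bar> < \<epsilon> \<Longrightarrow> (S has_real_derivative S' h) (at h)" "isCont S' 0" "S' 0 = - 1"
    using powser_derivative_near_0[OF \<epsilon> S] s by metis
  obtain P' where P': "\<And>h. \<bar>h\<bar> < \<epsilon> \<Longrightarrow> (P has_real_derivative P' h) (at h)" "P' 0 = c 1"
    using powser_derivative_near_0[OF \<epsilon> P] by metis
  have S0: "S 0 = 0" and P0: "P 0 = 0"
    using S[of 0] P[of 0] \<epsilon> s c0 by (simp_all add: sums_iff powser_zero)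
  \<comment> \<open>The chain rule gives \<open>c 1\<close> = S'(0)^2 = 1, so the deviation of
    \<open>P\<close> from its linear part is \<open>P h - h\<close>.\<close>
  have "((\<lambda>h. S (S h)) has_real_derivative S' (S 0) * S' 0) (at 0)"
    using S'(1)[of 0] \<epsilon> by (intro DERIV_chain2) (auto simp: S0)
  moreover have "\<forall>\<^sub>F h in nhds 0. S (S h) = P h"
    using PS by eventually_elim simp
  ultimately have "(P has_real_derivative S' (S 0) * S' 0) (at 0)"
    by (subst (asm) DERIV_cong_ev[OF refl _ refl]) auto
  then have c1: "c 1 = 1"
    using P'(1)[of 0] \<epsilon> P'(2) S'(3) S0 by (auto dest: DERIV_unique)
  obtain g where g: "\<And>h. \<bar>h\<bar> < \<epsilon> \<Longrightarrow> P h = c 1 * h + h ^ n * g h" "isCont g 0" "g 0 = c n"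
    using powser_leading_deviation[OF \<epsilon> P c0 least n] by metis
  \<comment> \<open>Multiplying by the sign of \<open>c n\<close> treats both signs of the deviation
    at once.\<close>
  define \<sigma> where "\<sigma> = sgn (c n)"
  have tS: "(S \<longlongrightarrow> 0) (nhds 0)" and tP: "(P \<longlongrightarrow> 0) (nhds 0)"
    using DERIV_isCont[OF S'(1)[of 0]] DERIV_isCont[OF P'(1)[of 0]] \<epsilon> S0 P0
      tendsto_at_iff_tendsto_nhds[of S 0] tendsto_at_iff_tendsto_nhds[of P 0] by (auto simp: isCont_def)
  have dev: "\<forall>\<^sub>F h in nhds 0. h \<noteq> 0 \<longrightarrow> \<sigma> * (P h - h) > 0"
  proof -
    have "((\<lambda>h. \<sigma> * g h) \<longlongrightarrow> \<sigma> * c n) (nhds 0)"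
      using g(2,3) tendsto_at_iff_tendsto_nhds[of g 0] by (auto simp: isCont_def intro!: tendsto_intros)
    moreover have "\<sigma> * c n > 0" using cn by (simp add: \<sigma>_def sgn_real_def)
    ultimately have "\<forall>\<^sub>F h in nhds 0. \<sigma> * g h > 0" by (rule order_tendstoD)
    moreover have "\<forall>\<^sub>F h in nhds 0. \<bar>h\<bar> < \<epsilon>"
      using \<epsilon> by (auto simp: eventually_nhds_metric)
    ultimately show ?thesis
    proof eventually_elim
      case (elim h)
      have "\<sigma> * (P h - h) = h ^ n * (\<sigma> * g h)" using g(1)[of h] c1 elim by simp
      moreover have "h ^ n > 0" if "h \<noteq> 0" using that even by (simp add: zero_less_power_eq)
      ultimately show ?case using elim by (simp only:) (blast intro: mult_pos_pos)
    qed
  qed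
  have "\<forall>\<^sub>F h in nhds 0. S' h < 0"
    using S'(2,3) tendsto_at_iff_tendsto_nhds[of S' 0]
    by (intro order_tendstoD(2)[of S' "- 1"]) (auto simp: isCont_def)
  then obtain d where d: "d > 0" "\<And>h. \<bar>h\<bar> < d \<Longrightarrow> S' h < 0"
    by (auto simp: eventually_nhds_metric)
  define e where "e = min d \<epsilon>"
  have e: "e > 0" using d \<epsilon> by (simp add: e_def)
  have dec: "S y < S x" if "x < y" "\<bar>x\<bar> < e" "\<bar>y\<bar> < e" for x y
  proof (rule DERIV_neg_imp_decreasing[OF that(1)])
    fix z assume "x \<le> z" "z \<le> y"
    then have "\<bar>z\<bar> < d" "\<bar>z\<bar> < \<epsilon>" using that by (auto simp: e_def)
    then show "\<exists>y. (S has_real_derivative y) (at z) \<and> y < 0" using S'(1) d(2) by blast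
  qed
  have near: "\<forall>\<^sub>F h in nhds 0. \<bar>h\<bar> < e" using e by (auto simp: eventually_nhds_metric)
  \<comment> \<open>The commutation comes from \<open>PS\<close> at \<open>h\<close> and at
    \<open>S h\<close>: both sides equal the third iterate of \<open>S\<close>.\<close>
  have "\<forall>\<^sub>F h in nhds 0. \<bar>h\<bar> < e \<and> \<bar>P h\<bar> < e \<and> P (S h) = S (P h) \<and>
      (h \<noteq> 0 \<longrightarrow> \<sigma> * (P h - h) > 0) \<and> (S h \<noteq> 0 \<longrightarrow> \<sigma> * (P (S h) - S h) > 0)"
    using near PS dev eventually_compose_filterlim[OF near tP]
      eventually_compose_filterlim[OF PS tS] eventually_compose_filterlim[OF dev tS]
    by eventually_elim simp
  then obtain d' where d': "d' > 0" "\<And>h. \<bar>h\<bar> < d' \<Longrightarrow> \<bar>h\<bar> < e \<and> \<bar>P h\<bar> < e \<and> P (S h) = S (P h) \<and>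
      (h \<noteq> 0 \<longrightarrow> \<sigma> * (P h - h) > 0) \<and> (S h \<noteq> 0 \<longrightarrow> \<sigma> * (P (S h) - S h) > 0)"
    unfolding eventually_nhds_metric dist_real_def diff_zero by meson
  define h where "h = d' / 2"
  have h: "h \<noteq> 0" "\<bar>h\<bar> < e" "\<bar>P h\<bar> < e" "P (S h) = S (P h)"
      "\<sigma> * (P h - h) > 0" "S h \<noteq> 0 \<longrightarrow> \<sigma> * (P (S h) - S h) > 0"
  proof -
    have "h \<noteq> 0" "\<bar>h\<bar> < d'" using d'(1) by (simp_all add: h_def)
    then show "h \<noteq> 0" "\<bar>h\<bar> < e" "\<bar>P h\<bar> < e" "P (S h) = S (P h)"
      "\<sigma> * (P h - h) > 0" "S h \<noteq> 0 \<longrightarrow> \<sigma> * (P (S h) - S h) > 0"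
      using d'(2)[of h] by blast+
  qed
  have "S h \<noteq> 0"
    using dec[of h 0] dec[of 0 h] h(1,2) e S0 by (cases "h < 0") auto
  then have *: "\<sigma> * (S (P h) - S h) > 0" using h by simp
  have "\<sigma> = 1 \<or> \<sigma> = - 1" using cn by (simp add: \<sigma>_def sgn_real_def)
  then consider "\<sigma> = 1" | "\<sigma> = - 1" by blast
  then show False
    using * h(2,3,5) dec[of h "P h"] dec[of "P h" h] by cases auto
qed

text \<open>The given expansion starts at exponent 1; a zero constant term brings it into the form
  of a full power series.\<close>

lemma sums_without_constant_term:
  fixes c :: "nat \<Rightarrow> real"
  assumes "(\<lambda>k. c (Suc k) * h ^ Suc k) sums l"
  shows "(\<lambda>k. (if k = 0 then 0 else c k) * h ^ k) sums l"
  using sums_Suc[of "\<lambda>k. (if k = 0 then 0 else c k) * h ^ k" l] assms by simp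

text \<open>If \<open>n\<close> were even, oddness of \<open>f\<close> would pass to the cofactor
  \<open>g\<close> of h^n away from 0, and continuity would force g(0) = -g(0), while g(0) =
  \<open>c n\<close>.\<close>

lemma odd_powser_leading_deviation:
  fixes c :: "nat \<Rightarrow> real"
  assumes \<epsilon>: "\<epsilon> > 0" and f: "\<And>h. \<bar>h\<bar> < \<epsilon> \<Longrightarrow> (\<lambda>k. c k * h ^ k) sums f h"
    and odd: "\<And>h. \<bar>h\<bar> < \<epsilon> \<Longrightarrow> f (- h) = - f h" and c0: "c 0 = 0"
    and n: "n > 1" and cn: "c n \<noteq> 0" and least: "\<And>k. 1 < k \<Longrightarrow> k < n \<Longrightarrow> c k = 0"
  shows "odd n"
proof
  assume even: "even n"
  obtain g where g: "\<And>h. \<bar>h\<bar> < \<epsilon> \<Longrightarrow> f h = c 1 * h + h ^ n * g h" "isCont g 0" "g 0 = c n"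
    using powser_leading_deviation[OF \<epsilon> f c0 least n] by metis
  have g_odd: "g (- h) = - g h" if h: "h \<noteq> 0" "\<bar>h\<bar> < \<epsilon>" for h
  proof -
    have "h ^ n * (g (- h) + g h) = 0"
      using odd[OF h(2)] g(1)[of h] g(1)[of "- h"] h(2) even by (simp add: algebra_simps)
    then show ?thesis using h(1) by (simp add: eq_neg_iff_add_eq_0)
  qed
  have lim: "(g \<longlongrightarrow> c n) (at 0)" using g(2,3) by (simp add: isCont_def)
  have "isCont (\<lambda>h. g (- h)) 0"
    using g(2) by (intro isCont_o2[of 0 uminus g]) auto
  then have "((\<lambda>h. g (- h)) \<longlongrightarrow> c n) (at 0)" using g(3) by (simp add: isCont_def)
  moreover have "\<forall>\<^sub>F h in at 0. g (- h) = - g h"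
    unfolding eventually_at using \<epsilon> g_odd by (intro exI[of _ \<epsilon>]) auto
  ultimately have "((\<lambda>h. - g h) \<longlongrightarrow> c n) (at 0)" by (rule Lim_transform_eventually)
  then have "c n = - c n" using tendsto_minus[OF lim] by (rule tendsto_unique[OF at_neq_bot])
  then show False using cn by simp
qed

section \<open>The return map for even and for odd weights\<close>

theorem theorem3p1:
  fixes p q :: nat
    and a b :: "nat \<Rightarrow> nat \<Rightarrow> real"
    and r :: "real \<Rightarrow> real \<Rightarrow> real"
    and \<nu> :: "nat \<Rightarrow> real \<Rightarrow> real"
  assumes "weight_system p q a b"
    and "solution_expansion p q a b r \<nu>"
    and "even (p + q)"
    and "\<exists>k>1. \<nu> k (2 * pi) \<noteq> 0"
  shows "odd (LEAST k. k > 1 \<and> \<nu> k (2 * pi) \<noteq> 0)"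
proof -
  define n where "n = (LEAST k. k > 1 \<and> \<nu> k (2 * pi) \<noteq> 0)"
  have n: "n > 1" "\<nu> n (2 * pi) \<noteq> 0"
    using LeastI_ex[of "\<lambda>k. k > 1 \<and> \<nu> k (2 * pi) \<noteq> 0"] assms(4) by (auto simp: n_def)
  have least: "\<nu> k (2 * pi) = 0" if "1 < k" "k < n" for k
    using not_less_Least[of k "\<lambda>k. k > 1 \<and> \<nu> k (2 * pi) \<noteq> 0"] that by (auto simp: n_def)
  define \<mu> where "\<mu> \<theta> k = (if k = 0 then 0 else \<nu> k \<theta>)" for \<theta> k
  have pq: "p > 0" "q > 0" using assms(1) by (auto simp: weight_system_def)
  obtain \<delta> where \<delta>: "\<delta> > 0" and sol: "\<And>h. \<bar>h\<bar> < \<delta> \<Longrightarrow> polar_solution p q a b h (\<lambda>\<theta>. r \<theta> h)"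
    using assms(2) by (auto simp: solution_expansion_def)
  have init: "r 0 h = h" if "\<bar>h\<bar> < \<delta>" for h
    using sol[OF that] by (simp add: polar_solution_def)
  have deriv: "((\<lambda>\<theta>. r \<theta> h) has_real_derivative polar_field p q a b \<theta> (r \<theta> h)) (at \<theta>)"
    if "\<bar>h\<bar> < \<delta>" "0 \<le> \<theta>" "\<theta> \<le> 2 * pi" for h \<theta>
    using polar_solution_deriv[OF sol[OF that(1)], of \<theta>] that pi_gt_zero by auto
  have expansion: "\<exists>\<epsilon>>0. \<forall>h. \<bar>h\<bar> < \<epsilon> \<longrightarrow> (\<lambda>k. \<mu> \<theta> k * h ^ k) sums r \<theta> h" if "\<bar>\<theta>\<bar> < 4 * pi" for \<theta>
  proof -
    have "\<exists>\<epsilon>>0. \<forall>h. \<bar>h\<bar> < \<epsilon> \<longrightarrow> (\<lambda>k. \<nu> (Suc k) \<theta> * h ^ Suc k) sums r \<theta> h"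
      using assms(2)[unfolded solution_expansion_def, THEN conjunct2] that by simp
    then show ?thesis
      unfolding \<mu>_def using sums_without_constant_term[of "\<lambda>k. \<nu> k \<theta>"] by meson
  qed
  obtain \<epsilon>1 where \<epsilon>1: "\<epsilon>1 > 0" "\<And>h. \<bar>h\<bar> < \<epsilon>1 \<Longrightarrow> (\<lambda>k. \<mu> pi k * h ^ k) sums r pi h"
    using expansion[of pi] by auto
  obtain \<epsilon>2 where \<epsilon>2: "\<epsilon>2 > 0" "\<And>h. \<bar>h\<bar> < \<epsilon>2 \<Longrightarrow> (\<lambda>k. \<mu> (2 * pi) k * h ^ k) sums r (2 * pi) h"
    using expansion[of "2 * pi"] by auto
  obtain \<eta> where \<eta>: "\<eta> > 0" and unique:
    "\<And>u v T. 0 \<le> T \<Longrightarrow> T \<le> 2 * pi \<Longrightarrow> \<bar>u 0\<bar> < \<eta> \<Longrightarrow> u 0 = v 0 \<Longrightarrow>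
      (\<And>\<theta>. 0 \<le> \<theta> \<Longrightarrow> \<theta> \<le> T \<Longrightarrow> (u has_real_derivative polar_field p q a b \<theta> (u \<theta>)) (at \<theta>)) \<Longrightarrow>
      (\<And>\<theta>. 0 \<le> \<theta> \<Longrightarrow> \<theta> \<le> T \<Longrightarrow> (v has_real_derivative polar_field p q a b \<theta> (v \<theta>)) (at \<theta>)) \<Longrightarrow>
      u T = v T"
    using polar_field_unique[OF assms(1)] by metis
  show ?thesis
  proof (cases "even p")
    case True
    then have even: "even p" "even q" using assms(3) by auto
    define e where "e = min \<epsilon>2 (min \<delta> \<eta>)"
    have "r (2 * pi) (- h) = - r (2 * pi) h" if h: "\<bar>h\<bar> < e" for h
    proof (rule unique[of "2 * pi" "\<lambda>\<theta>. r \<theta> (- h)" "\<lambda>\<theta>. - r \<theta> h"])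
      show "\<bar>r 0 (- h)\<bar> < \<eta>" "r 0 (- h) = - r 0 h" using h by (simp_all add: init e_def)
      show "((\<lambda>\<theta>. r \<theta> (- h)) has_real_derivative polar_field p q a b \<theta> (r \<theta> (- h))) (at \<theta>)"
        if "0 \<le> \<theta>" "\<theta> \<le> 2 * pi" for \<theta>
        using that h by (intro deriv) (auto simp: e_def)
      show "((\<lambda>\<theta>. - r \<theta> h) has_real_derivative polar_field p q a b \<theta> (- r \<theta> h)) (at \<theta>)"
        if "0 \<le> \<theta>" "\<theta> \<le> 2 * pi" for \<theta>
        unfolding polar_field_uminus[OF even] using that h by (intro DERIV_minus deriv) (auto simp: e_def)
    qed auto
    then have "odd n"
      using odd_powser_leading_deviation[of e "\<mu> (2 * pi)" "r (2 * pi)" n] \<epsilon>2 \<delta> \<eta> n least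
      by (simp add: e_def \<mu>_def)
    then show ?thesis by (simp add: n_def)
  next
    case False
    then have odd: "odd p" "odd q" using assms(3) by auto
    define S where "S h = - r pi h" for h
    define e where "e = min \<epsilon>1 \<epsilon>2"
    have e: "e > 0" using \<epsilon>1 \<epsilon>2 by (simp add: e_def)
    have Ssums: "(\<lambda>k. - \<mu> pi k * h ^ k) sums S h" if "\<bar>h\<bar> < e" for h
      using sums_minus[OF \<epsilon>1(2)[of h]] that by (simp add: S_def e_def)
    have S0: "S 0 = 0"
    proof -
      have "(\<lambda>k. - \<mu> pi k * 0 ^ k) sums S 0" by (rule Ssums) (use e in simp)
      then have "- \<mu> pi 0 = S 0" by (simp only: powser_sums_zero_iff)
      then show ?thesis by (simp add: \<mu>_def)
    qed
    obtain D where D: "\<And>h. \<bar>h\<bar> < e \<Longrightarrow> (S has_real_derivative D h) (at h)"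
        "isCont D 0" "D 0 = - \<mu> pi 1"
      using powser_derivative_near_0[OF e Ssums] by metis
    have S': "(S has_real_derivative - \<mu> pi 1) (at 0)" using D(1)[of 0] e by (simp add: D(3))
    obtain \<kappa> M where \<kappa>: "\<kappa> > 0" and quad:
      "\<And>u. \<bar>u 0\<bar> < \<kappa> \<Longrightarrow>
        (\<And>\<theta>. 0 \<le> \<theta> \<Longrightarrow> \<theta> \<le> pi \<Longrightarrow> (u has_real_derivative polar_field p q a b \<theta> (u \<theta>)) (at \<theta>)) \<Longrightarrow>
        \<bar>u pi - u 0\<bar> \<le> M * (u 0)\<^sup>2"
      using half_turn_tangent_identity[OF assms(1)] by metis
    have S_quad: "\<bar>S h + h\<bar> \<le> M * h\<^sup>2" if h: "\<bar>h\<bar> < min \<delta> \<kappa>" for h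
    proof -
      have "\<bar>r pi h - r 0 h\<bar> \<le> M * (r 0 h)\<^sup>2"
        by (rule quad[of "\<lambda>\<theta>. r \<theta> h"]) (use h in \<open>auto simp: init intro!: deriv\<close>)
      then show ?thesis using h by (simp add: init S_def)
    qed
    \<comment> \<open>The expansion already gives the derivative of \<open>S\<close> at 0 as
      \<open>- \<mu> pi 1\<close>. The quadratic estimate computes the same derivative from the
      equation, and uniqueness of derivatives then determines the coefficient.\<close>
    have "(S has_real_derivative - 1) (at 0)"
      unfolding DERIV_def
    proof (rule LIM_zero_cancel, rule Lim_null_comparison)
      have "\<forall>\<^sub>F h in at 0. h \<noteq> 0 \<and> \<bar>h\<bar> < min \<delta> \<kappa>"
        unfolding eventually_at using \<delta> \<kappa> by (intro exI[of _ "min \<delta> \<kappa>"]) auto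
      then show "\<forall>\<^sub>F h in at 0. norm ((S (0 + h) - S 0) / h - - 1) \<le> M * \<bar>h\<bar>"
      proof eventually_elim
        case (elim h)
        have "(S (0 + h) - S 0) / h - - 1 = (S h + h) / h"
          using elim by (simp add: S0 field_simps)
        then have "norm ((S (0 + h) - S 0) / h - - 1) = \<bar>S h + h\<bar> / \<bar>h\<bar>" by simp
        also have "\<dots> \<le> M * h\<^sup>2 / \<bar>h\<bar>" using S_quad elim by (intro divide_right_mono) auto
        also have "\<dots> = M * \<bar>h\<bar>"
          using elim by (simp add: field_simps power2_eq_square)
        finally show ?case .
      qed
      show "((\<lambda>h. M * \<bar>h\<bar>) \<longlongrightarrow> 0) (at (0::real))" by (auto intro!: tendsto_eq_intros)
    qed
    then have s1: "- \<mu> pi 1 = - 1" using S' by (rule DERIV_unique[rotated])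
    have "(S \<longlongrightarrow> 0) (nhds 0)"
      using DERIV_isCont[OF S'] S0 tendsto_at_iff_tendsto_nhds[of S 0] by (auto simp: isCont_def)
    moreover have "\<forall>\<^sub>F h in nhds 0. \<bar>h\<bar> < min \<delta> \<eta>"
      using \<delta> \<eta> by (subst eventually_nhds_metric) (auto intro!: exI[of _ "min \<delta> \<eta>"])
    ultimately have "\<forall>\<^sub>F h in nhds 0. \<bar>S h\<bar> < min \<delta> \<eta>" "\<forall>\<^sub>F h in nhds 0. \<bar>h\<bar> < min \<delta> \<eta>"
      using eventually_compose_filterlim by blast+
    then have PS: "\<forall>\<^sub>F h in nhds 0. r (2 * pi) h = S (S h)"
    proof eventually_elim
      case (elim h)
      \<comment> \<open>The orbit of \<open>h\<close> after a half turn, reflected, starts at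
        \<open>S h\<close> and solves the same equation, so it is the orbit of \<open>S h\<close>;
        following it for another half turn reaches the return map.\<close>
      have "r pi (S h) = - r (pi + pi) h"
      proof (rule unique[of pi "\<lambda>\<theta>. r \<theta> (S h)" "\<lambda>\<theta>. - r (\<theta> + pi) h"])
        show "\<bar>r 0 (S h)\<bar> < \<eta>" "r 0 (S h) = - r (0 + pi) h" using elim by (simp_all add: init S_def)
        show "((\<lambda>\<theta>. r \<theta> (S h)) has_real_derivative polar_field p q a b \<theta> (r \<theta> (S h))) (at \<theta>)"
          if "0 \<le> \<theta>" "\<theta> \<le> pi" for \<theta>
          using that elim by (intro deriv) auto
        show "((\<lambda>\<theta>. - r (\<theta> + pi) h) has_real_derivative polar_field p q a b \<theta> (- r (\<theta> + pi) h)) (at \<theta>)"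
          if \<theta>: "0 \<le> \<theta>" "\<theta> \<le> pi" for \<theta>
        proof -
          have "((\<lambda>\<theta>. r (\<theta> + pi) h) has_real_derivative polar_field p q a b (\<theta> + pi) (r (\<theta> + pi) h)) (at \<theta>)"
            using \<theta> elim by (intro iffD1[OF DERIV_shift[of "\<lambda>\<theta>. r \<theta> h" _ \<theta> pi]] deriv) auto
          then have "((\<lambda>\<theta>. - r (\<theta> + pi) h) has_real_derivative
              - polar_field p q a b (\<theta> + pi) (r (\<theta> + pi) h)) (at \<theta>)"
            by (rule DERIV_minus)
          then show ?thesis
            using polar_field_antipodal[OF odd pq, of a b \<theta> "- r (\<theta> + pi) h"] by simp
        qed
      qed auto
      then show ?case by (simp add: S_def)
    qed
    have "odd n"
    proof (rule reversing_square_deviation_odd[OF e Ssums _ s1 _ _ PS n(1)])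
      show "(\<lambda>k. \<mu> (2 * pi) k * h ^ k) sums r (2 * pi) h" if "\<bar>h\<bar> < e" for h
        using \<epsilon>2(2) that by (simp add: e_def)
      show "\<mu> (2 * pi) n \<noteq> 0" using n by (simp add: \<mu>_def)
      show "\<mu> (2 * pi) k = 0" if "1 < k" "k < n" for k using least[OF that] by (simp add: \<mu>_def)
    qed (simp_all add: \<mu>_def)
    then show ?thesis by (simp add: n_def)
  qed
qed

end
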